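(* Let $\mathbb{F}$ be an algebraically closed field of characteristic $2$, let $n\geq 5$, and let $V$ be an irreducible $\mathbb{F}\mathsf{A}_n$-module. Suppose that $V$ does not extend to $\mathsf{S}_n$. Then $\dim V\geq 2^{(n-6)/4}$.
   Context: $\mathsf{S}_n$ and $\mathsf{A}_n$ are the symmetric and alternating groups of degree $n$. $V$ extends to $\mathsf{S}_n$ if there is an $\mathbb{F}\mathsf{S}_n$-module whose restriction to $\mathsf{A}_n$ is isomorphic to $V$. *)

theory Defs
  imports "HOL-Algebra.Algebra" "HOL-Computational_Algebra.Computational_Algebra" Complex_Main
begin

text \<open>
  A module over the group algebra of \<open>G\<close> over a field is a vector space (the whole type \<open>'v\<close>,
  with scalar multiplication \<open>scale\<close>) on which \<open>G\<close> acts by linear maps. Only the values of the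
  action \<open>\<rho>\<close> on \<open>carrier G\<close> matter, so the restriction of a module to a subgroup is given by the
  same \<open>scale\<close> and \<open>\<rho>\<close>.
\<close>

locale group_module =
  vector_space scale + group_action G UNIV \<rho>
  for G :: "('g, 'm) monoid_scheme" (structure)
    and scale :: "'a::field \<Rightarrow> 'v::ab_group_add \<Rightarrow> 'v"
    and \<rho> :: "'g \<Rightarrow> 'v \<Rightarrow> 'v" +
  assumes linear_action: "g \<in> carrier G \<Longrightarrow> Vector_Spaces.linear scale scale (\<rho> g)"
begin

definition group_submodule :: "'v set \<Rightarrow> bool" where
  "group_submodule W \<longleftrightarrow> subspace W \<and> (\<forall>g\<in>carrier G. \<forall>w\<in>W. \<rho> g w \<in> W)"

end

locale irreducible_group_module = group_module G scale \<rho>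
  for G :: "('g, 'm) monoid_scheme" (structure)
    and scale :: "'a::field \<Rightarrow> 'v::ab_group_add \<Rightarrow> 'v"
    and \<rho> :: "'g \<Rightarrow> 'v \<Rightarrow> 'v" +
  assumes nonzero: "(UNIV :: 'v set) \<noteq> {0}"
    and group_submodule_trivial: "group_submodule W \<Longrightarrow> W = {0} \<or> W = UNIV"

definition group_module_iso ::
  "('g, 'm) monoid_scheme \<Rightarrow> ('a::field \<Rightarrow> 'v::ab_group_add \<Rightarrow> 'v) \<Rightarrow> ('g \<Rightarrow> 'v \<Rightarrow> 'v) \<Rightarrow>
    ('a \<Rightarrow> 'w::ab_group_add \<Rightarrow> 'w) \<Rightarrow> ('g \<Rightarrow> 'w \<Rightarrow> 'w) \<Rightarrow> ('v \<Rightarrow> 'w) \<Rightarrow> bool"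
where
  "group_module_iso G scale \<rho> scale' \<sigma> f \<longleftrightarrow>
     Vector_Spaces.linear scale scale' f \<and> bij f \<and>
     (\<forall>g\<in>carrier G. \<forall>v. f (\<rho> g v) = \<sigma> g (f v))"

text \<open>
  The module for the symmetric group is taken on the type \<open>'v\<close> of the given module, because HOL
  cannot quantify over types inside a formula. This loses no generality:
  see \<open>extends_to_symI\<close> below.
\<close>

definition extends_to_sym ::
  "nat \<Rightarrow> ('a::field \<Rightarrow> 'v::ab_group_add \<Rightarrow> 'v) \<Rightarrow> ((nat \<Rightarrow> nat) \<Rightarrow> 'v \<Rightarrow> 'v) \<Rightarrow> bool"
where
  "extends_to_sym n scale \<rho> \<longleftrightarrow>
     (\<exists>(scale' :: 'a \<Rightarrow> 'v \<Rightarrow> 'v) \<sigma> f. group_module (sym_group n) scale' \<sigma> \<and>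
        group_module_iso (alt_group n) scale' \<sigma> scale \<rho> f)"

lemma group_module_transport:
  assumes W: "group_module G scale' \<sigma>"
    and lin: "Vector_Spaces.linear scale' scale f" and bij: "bij f"
  shows "group_module G scale (\<lambda>g. f \<circ> \<sigma> g \<circ> inv_into UNIV f)"
proof -
  interpret W: group_module G scale' \<sigma> by (fact W)
  interpret f: Vector_Spaces.linear scale' scale f by (fact lin)
  have inv_f: "f (inv_into UNIV f x) = x" "inv_into UNIV f (f y) = y" for x y
    using bij by (simp_all add: bij_is_surj surj_f_inv_f bij_is_inj)
  have lin_inv: "Vector_Spaces.linear scale scale' (inv_into UNIV f)"
    unfolding linear_iff_module_hom module_hom_iff module_iff_vector_space
    using inv_f by (metis f.add f.scale W.vector_space_axioms f.vs2.vector_space_axioms)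
  have bij_conj: "bij (f \<circ> \<sigma> g \<circ> inv_into UNIV f)" if "g \<in> carrier G" for g
    using W.bij_prop0[OF that] bij by (auto simp: Bij_def intro!: bij_comp bij_imp_bij_inv)
  have mult: "\<sigma> (g \<otimes>\<^bsub>G\<^esub> h) = \<sigma> g \<circ> \<sigma> h" if "g \<in> carrier G" "h \<in> carrier G" for g h
    using group_hom.hom_mult[OF W.group_hom that] W.bij_prop0 that
    by (auto simp: BijGroup_def compose_def fun_eq_iff)
  have "group_hom G (BijGroup UNIV) (\<lambda>g. f \<circ> \<sigma> g \<circ> inv_into UNIV f)"
  proof (intro group_hom.intro group_hom_axioms.intro group_BijGroup homI)
    show "Group.group G" using W.group_hom by (simp add: group_hom_def)
    show "f \<circ> \<sigma> g \<circ> inv_into UNIV f \<in> carrier (BijGroup UNIV)" if "g \<in> carrier G" for g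
      using bij_conj[OF that] by (simp add: BijGroup_def Bij_def)
    show "f \<circ> \<sigma> (g \<otimes>\<^bsub>G\<^esub> h) \<circ> inv_into UNIV f
        = (f \<circ> \<sigma> g \<circ> inv_into UNIV f) \<otimes>\<^bsub>BijGroup UNIV\<^esub> (f \<circ> \<sigma> h \<circ> inv_into UNIV f)"
      if "g \<in> carrier G" "h \<in> carrier G" for g h
      using bij_conj that
      by (simp add: BijGroup_def Bij_def compose_def mult inv_f fun_eq_iff)
  qed
  moreover have "Vector_Spaces.linear scale scale (f \<circ> \<sigma> g \<circ> inv_into UNIV f)" if "g \<in> carrier G" for g
    using Vector_Spaces.linear_compose[OF Vector_Spaces.linear_compose[OF lin_inv W.linear_action[OF that]] lin]
    by (simp add: comp_assoc)
  ultimately show ?thesis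
    by (intro group_module.intro group_action.intro group_module_axioms.intro f.vs2.vector_space_axioms)
qed

lemma extends_to_symI:
  fixes scale' :: "'a::field \<Rightarrow> 'w::ab_group_add \<Rightarrow> 'w"
    and scale :: "'a \<Rightarrow> 'v::ab_group_add \<Rightarrow> 'v"
  assumes W: "group_module (sym_group n) scale' \<sigma>"
    and iso: "group_module_iso (alt_group n) scale' \<sigma> scale \<rho> f"
  shows "extends_to_sym n scale \<rho>"
proof -
  have lin: "Vector_Spaces.linear scale' scale f" and bij: "bij f"
    and eq: "\<And>g v. g \<in> carrier (alt_group n) \<Longrightarrow> f (\<sigma> g v) = \<rho> g (f v)"
    using iso by (auto simp: group_module_iso_def)
  interpret f: Vector_Spaces.linear scale' scale f by (fact lin)
  have surj: "f (inv_into UNIV f v) = v" for v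
    using bij by (simp add: bij_is_surj surj_f_inv_f)
  have "group_module_iso (alt_group n) scale (\<lambda>g. f \<circ> \<sigma> g \<circ> inv_into UNIV f) scale \<rho> id"
    unfolding group_module_iso_def
    by (auto simp: eq surj f.vs2.linear_id)
  with group_module_transport[OF W lin bij] show ?thesis
    unfolding extends_to_sym_def by blast
qed

end

theory Submission
  imports Defs
begin

text \<open>
  Cut the points into \<open>r = n div 3\<close> blocks of three. In characteristic 2 the three-cycles on the
  blocks are commuting semisimple operators with eigenvalues \<open>1\<close>, \<open>\<omega>\<close>, \<open>\<omega>\<^sup>2\<close>, so the module has
  weights: functions that give an eigenvalue to each block. Let \<open>k\<close> be the largest number of
  nontrivial eigenvalues in a weight, where the blocks may be chosen freely. The two halves of the
  proof show that a module with small \<open>k\<close> extends and that one with large \<open>k\<close> has many weights.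

  Small \<open>k\<close>. Let \<open>U\<close> be the joint eigenspace of a weight vector for its \<open>k\<close> nontrivial three-cycles,
  and let \<open>Y\<close> be the set of the other \<open>n - 3k\<close> points. A three-cycle on \<open>Y\<close> that acts nontrivially on
  \<open>U\<close> would give a weight with \<open>k + 1\<close> nontrivial eigenvalues, so all even permutations of \<open>Y\<close> fix \<open>U\<close>
  pointwise. Let \<open>w \<in> U\<close> be nonzero, let \<open>p\<close> be the projection onto \<open>U\<close>, which commutes with these
  permutations, and let \<open>s\<close> be a transposition of two points of \<open>Y\<close>. If \<open>n - 3k \<ge> 3k + 2\<close>, then every
  \<open>g\<close> sends two points of \<open>Y\<close> into \<open>Y\<close>, so \<open>s g s = x g y\<close> with \<open>x\<close> and \<open>y\<close> even permutations of \<open>Y\<close>;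
  hence \<open>p (g w) = p (s g s w)\<close>. A nonzero matrix coefficient that
  is invariant under conjugation by \<open>s\<close> makes the module isomorphic to its conjugate, by the map
  \<open>\<Sum> c\<^sub>g g w \<mapsto> \<Sum> c\<^sub>g s g s w\<close> (\<open>twist_involution\<close>). This map is an involution, so it can be taken as the
  action of \<open>s\<close>, and the module extends (\<open>extends_to_sym_of_twist\<close>).

  Large \<open>k\<close>. If the module does not extend, then \<open>n \<le> 6k + 1\<close> and so \<open>r \<le> 2k\<close>
  (\<open>weight_of_nonextending\<close>). Permuting the blocks, and reversing some of them, moves one weight with
  \<open>k\<close> nontrivial eigenvalues to all \<open>(r choose k) 2\<^sup>k \<ge> 2\<^sup>r\<close> functions with \<open>k\<close> nontrivial values. Half of
  them at least are reached by even permutations. Vectors of different weights are independent, so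
  the dimension is at least \<open>2\<close> to the power \<open>r - 1\<close>, and \<open>r - 1 \<ge> (n - 6) / 4\<close>.
\<close>

section \<open>Three-cycles\<close>

definition three_cycle :: "'a \<Rightarrow> 'a \<Rightarrow> 'a \<Rightarrow> 'a \<Rightarrow> 'a" where
  "three_cycle a b c = transpose a b \<circ> transpose b c"

lemma three_cycle_permutes: "a \<in> S \<Longrightarrow> b \<in> S \<Longrightarrow> c \<in> S \<Longrightarrow> three_cycle a b c permutes S"
  unfolding three_cycle_def by (intro permutes_compose permutes_swap_id)

lemma evenperm_transpose_comp:
  "a \<noteq> b \<Longrightarrow> c \<noteq> d \<Longrightarrow> evenperm (transpose a b \<circ> transpose c d)"
  by (simp add: evenperm_comp evenperm_swap permutation_swap_id)

lemma evenperm_three_cycle: "a \<noteq> b \<Longrightarrow> b \<noteq> c \<Longrightarrow> evenperm (three_cycle a b c)"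
  unfolding three_cycle_def by (rule evenperm_transpose_comp)

lemma transpose_comp_conj: "inj f \<Longrightarrow> f \<circ> transpose a b = transpose (f a) (f b) \<circ> f"
  by (auto simp: fun_eq_iff transpose_def inj_eq)

lemma three_cycle_conj: "inj f \<Longrightarrow> f \<circ> three_cycle a b c = three_cycle (f a) (f b) (f c) \<circ> f"
  by (auto simp: three_cycle_def fun_eq_iff transpose_def inj_eq)

lemma three_cycle_square:
  "distinct [a, b, c] \<Longrightarrow> three_cycle a b c \<circ> three_cycle a b c = three_cycle b a c"
  by (auto simp: three_cycle_def fun_eq_iff transpose_def)

lemma three_cycle_cube:
  "distinct [a, b, c] \<Longrightarrow> three_cycle a b c \<circ> (three_cycle a b c \<circ> three_cycle a b c) = id"
  by (auto simp: three_cycle_def fun_eq_iff transpose_def)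

lemma comp_three_cycle_commute:
  "inj f \<Longrightarrow> f a = a \<Longrightarrow> f b = b \<Longrightarrow> f c = c \<Longrightarrow> f \<circ> three_cycle a b c = three_cycle a b c \<circ> f"
  by (simp add: three_cycle_conj)

lemma three_cycle_fixes: "x \<notin> {a, b, c} \<Longrightarrow> three_cycle a b c x = x"
  by (auto simp: three_cycle_def transpose_def)

text \<open>
  Induction principle for even permutations of \<open>Y\<close> that are products of two transpositions: such a
  product is \<open>(a b)(b c) \<circ> (b c)(c d)\<close>, and two transpositions with a common point give a three-cycle
  or the identity.
\<close>

lemma transposition_pair_induct:
  assumes "a \<noteq> b" "c \<noteq> d"
    and cycles: "\<And>a b c. \<lbrakk>a \<in> Y; b \<in> Y; c \<in> Y; distinct [a, b, c]\<rbrakk> \<Longrightarrow> P (three_cycle a b c)"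
    and id: "P id" and comp: "\<And>f g. P f \<Longrightarrow> P g \<Longrightarrow> P (f \<circ> g)"
    and Y: "a \<in> Y" "b \<in> Y" "c \<in> Y" "d \<in> Y"
  shows "P (transpose a b \<circ> transpose c d)"
proof -
  have neighbours: "P (transpose x y \<circ> transpose y z)"
    if "x \<in> Y" "y \<in> Y" "z \<in> Y" "x \<noteq> y" "y \<noteq> z" for x y z
  proof (cases "x = z")
    case True
    then have "transpose x y \<circ> transpose y z = id"
      by (auto simp: fun_eq_iff transpose_def)
    then show ?thesis using id by simp
  next
    case False
    then show ?thesis using cycles[of x y z] that by (simp add: three_cycle_def)
  qed
  show ?thesis
  proof (cases "b = c")
    case True
    then show ?thesis using neighbours[of a b d] assms by simp
  next
    case False
    have "transpose a b \<circ> transpose c d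
        = (transpose a b \<circ> transpose b c) \<circ> (transpose b c \<circ> transpose c d)"
      by (simp add: fun_eq_iff)
    then show ?thesis
      using comp[OF neighbours[of a b c] neighbours[of b c d]] False assms by simp
  qed
qed

section \<open>Twisting an irreducible module by an involution\<close>

context group_module
begin

lemma act_mult: "g \<in> carrier G \<Longrightarrow> h \<in> carrier G \<Longrightarrow> \<rho> (g \<otimes> h) v = \<rho> g (\<rho> h v)"
  by (simp add: composition_rule)

lemma act_one: "\<rho> \<one> v = v"
  using id_eq_one by (metis UNIV_I restrict_apply)

lemma act_add: "g \<in> carrier G \<Longrightarrow> \<rho> g (v + w) = \<rho> g v + \<rho> g w"
  by (meson linear_action Vector_Spaces.linear_iff_module_hom module_hom.add)

lemma act_scale: "g \<in> carrier G \<Longrightarrow> \<rho> g (scale c v) = scale c (\<rho> g v)"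
  by (meson linear_action Vector_Spaces.linear_iff_module_hom module_hom.scale)

lemma act_zero: "g \<in> carrier G \<Longrightarrow> \<rho> g 0 = 0"
  by (meson linear_action Vector_Spaces.linear_iff_module_hom module_hom.zero)

lemma act_sum: "g \<in> carrier G \<Longrightarrow> \<rho> g (sum f A) = (\<Sum>x\<in>A. \<rho> g (f x))"
  by (rule module_hom.sum[OF linear_action[unfolded Vector_Spaces.linear_iff_module_hom]])

lemma group_G: "Group.group G"
  using group_hom by (simp add: group_hom_def)

text \<open>
  The image of the element \<open>\<Sum> c\<^sub>g g\<close> of the group algebra under the map that applies it to \<open>w\<close>.
\<close>

definition orbit_comb :: "'v \<Rightarrow> ('g \<Rightarrow> 'a) \<Rightarrow> 'v" where
  "orbit_comb w c = (\<Sum>g\<in>carrier G. scale (c g) (\<rho> g w))"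

lemma orbit_comb_add: "orbit_comb w c + orbit_comb w d = orbit_comb w (\<lambda>g. c g + d g)"
  by (simp add: orbit_comb_def scale_left_distrib sum.distrib)

lemma orbit_comb_diff: "orbit_comb w c - orbit_comb w d = orbit_comb w (\<lambda>g. c g - d g)"
  by (simp add: orbit_comb_def scale_left_diff_distrib sum_subtractf)

lemma orbit_comb_scale: "scale a (orbit_comb w c) = orbit_comb w (\<lambda>g. a * c g)"
  by (simp add: orbit_comb_def scale_sum_right)

lemma act_orbit_comb:
  assumes h: "h \<in> carrier G"
  shows "\<rho> h (orbit_comb w c) = orbit_comb w (\<lambda>g. c (inv h \<otimes> g))"
proof -
  interpret Group.group G by (rule group_G)
  have "\<rho> h (orbit_comb w c) = (\<Sum>g\<in>carrier G. scale (c g) (\<rho> (h \<otimes> g) w))"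
    unfolding orbit_comb_def using h by (simp add: act_sum act_scale act_mult)
  also have "\<dots> = orbit_comb w (\<lambda>g. c (inv h \<otimes> g))"
    unfolding orbit_comb_def
    by (rule sum.reindex_bij_witness[of _ "\<lambda>g. inv h \<otimes> g" "\<lambda>g. h \<otimes> g"])
       (use h in \<open>auto simp: m_assoc[symmetric]\<close>)
  finally show ?thesis .
qed

end

context irreducible_group_module
begin

lemma orbit_comb_surj:
  assumes fin: "finite (carrier G)" and w: "w \<noteq> 0"
  obtains c where "orbit_comb w c = v"
proof -
  interpret Group.group G by (rule group_G)
  have "group_submodule (range (orbit_comb w))"
    unfolding group_submodule_def
  proof (intro conjI ballI)
    have "0 = orbit_comb w (\<lambda>_. 0)" by (simp add: orbit_comb_def)
    then show "subspace (range (orbit_comb w))"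
      by (auto simp: subspace_def orbit_comb_add orbit_comb_scale)
  qed (auto simp: act_orbit_comb)
  moreover have "w \<in> range (orbit_comb w)"
  proof
    show "w = orbit_comb w (\<lambda>g. if g = \<one> then 1 else 0)"
      using fin by (simp add: orbit_comb_def if_distrib[of "\<lambda>a. scale a _"] act_one cong: if_cong)
  qed simp
  ultimately have "range (orbit_comb w) = UNIV"
    using group_submodule_trivial w by fastforce
  then show ?thesis using that by (metis surjD)
qed

text \<open>
  An irreducible module with a nonzero matrix coefficient \<open>g \<mapsto> p (g w)\<close> that is invariant under an
  involutive automorphism \<open>s\<close> is isomorphic to its twist by \<open>s\<close>. The isomorphism sends
  \<open>\<Sum> c\<^sub>g g w\<close> to \<open>\<Sum> c\<^sub>g s(g) w\<close>. It is well defined because, if the first sum vanishes, every translate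
  of the second one is killed by \<open>p\<close>, and the vectors all of whose translates are killed by \<open>p\<close> form a
  proper submodule. The formula shows that it is an involution, so no scalar from Schur's lemma has
  to be removed later.
\<close>

lemma twist_involution:
  assumes fin: "finite (carrier G)"
    and s_closed: "\<And>g. g \<in> carrier G \<Longrightarrow> s g \<in> carrier G"
    and s_s: "\<And>g. g \<in> carrier G \<Longrightarrow> s (s g) = g"
    and s_mult: "\<And>g h. g \<in> carrier G \<Longrightarrow> h \<in> carrier G \<Longrightarrow> s (g \<otimes> h) = s g \<otimes> s h"
    and p: "Vector_Spaces.linear scale scale p" and u: "p u \<noteq> 0" and w: "w \<noteq> 0"
    and coeff: "\<And>g. g \<in> carrier G \<Longrightarrow> p (\<rho> (s g) w) = p (\<rho> g w)"
  obtains T where "Vector_Spaces.linear scale scale T" "\<And>v. T (T v) = v"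
    "\<And>g v. g \<in> carrier G \<Longrightarrow> T (\<rho> g v) = \<rho> (s g) (T v)"
proof -
  interpret Group.group G by (rule group_G)
  interpret p: Vector_Spaces.linear scale scale p by (fact p)
  define E where "E = orbit_comb w"
  have E_twist: "E (\<lambda>g. c (s g)) = (\<Sum>g\<in>carrier G. scale (c g) (\<rho> (s g) w))" for c
    unfolding E_def orbit_comb_def
    by (rule sum.reindex_bij_witness[of _ s s]) (auto simp: s_closed s_s)
  have twist_0: "E (\<lambda>g. c (s g)) = 0" if 0: "E c = 0" for c
  proof -
    have p_0: "p (\<rho> (s h) (E (\<lambda>g. c (s g)))) = 0" if h: "h \<in> carrier G" for h
    proof -
      have "p (\<rho> (s h) (E (\<lambda>g. c (s g)))) = (\<Sum>g\<in>carrier G. scale (c g) (p (\<rho> (s (h \<otimes> g)) w)))"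
        using h by (simp add: E_twist act_sum act_scale p.sum p.scale s_mult s_closed act_mult)
      also have "\<dots> = (\<Sum>g\<in>carrier G. scale (c g) (p (\<rho> (h \<otimes> g) w)))"
        using h by (simp add: coeff)
      also have "\<dots> = p (\<rho> h (E c))"
        using h by (simp add: E_def orbit_comb_def act_sum act_scale p.sum p.scale act_mult)
      finally show ?thesis using h 0 by (simp add: act_zero p.zero)
    qed
    \<comment> \<open>The largest submodule in the kernel of \<open>p\<close>.\<close>
    define K where "K = {y. \<forall>h\<in>carrier G. p (\<rho> h y) = 0}"
    have "group_submodule K"
      unfolding group_submodule_def subspace_def K_def
      by (auto simp: act_add act_scale act_zero p.add p.scale p.zero act_mult[symmetric])
    moreover have "u \<notin> K"
      using u unfolding K_def by (auto intro!: bexI[of _ \<one>] simp: act_one)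
    ultimately have "K = {0}" using group_submodule_trivial by blast
    moreover have "E (\<lambda>g. c (s g)) \<in> K"
      unfolding K_def
    proof (intro CollectI ballI)
      show "p (\<rho> h (E (\<lambda>g. c (s g)))) = 0" if "h \<in> carrier G" for h
        using p_0[OF s_closed[OF that]] by (simp add: s_s that)
    qed
    ultimately show ?thesis by simp
  qed
  have E_surj: "\<exists>c. v = E c" for v
    using orbit_comb_surj[OF fin w] unfolding E_def by metis
  define T where "T v = E (\<lambda>g. (SOME c. v = E c) (s g))" for v
  have T_E: "T (E c) = E (\<lambda>g. c (s g))" for c
  proof -
    have "E c = E (SOME d. E c = E d)" by (rule someI[of _ c]) (rule refl)
    then have "E (\<lambda>g. (SOME d. E c = E d) g - c g) = 0"
      by (simp add: E_def orbit_comb_diff[symmetric])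
    from twist_0[OF this] show ?thesis
      by (simp add: T_def E_def orbit_comb_diff[symmetric])
  qed
  show ?thesis
  proof
    show "Vector_Spaces.linear scale scale T"
    proof (intro Vector_Spaces.linear_iff_module_hom[THEN iffD2] module_hom.intro
        module_hom_axioms.intro)
      fix v v' :: 'v and a :: 'a
      obtain c d where cd: "v = E c" "v' = E d" using E_surj by metis
      have "v + v' = E (\<lambda>g. c g + d g)" "scale a v = E (\<lambda>g. a * c g)"
        by (simp_all add: cd E_def orbit_comb_add orbit_comb_scale)
      then show "T (v + v') = T v + T v'" "T (scale a v) = scale a (T v)"
        by (simp_all only: T_E cd) (simp_all add: E_def orbit_comb_add orbit_comb_scale)
    qed (rule module_axioms)+
    show "T (T v) = v" for v
    proof -
      obtain c where c: "v = E c" using E_surj by metis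
      have "E (\<lambda>g. c (s (s g))) = E c"
        unfolding E_def orbit_comb_def by (intro sum.cong) (auto simp: s_s)
      then show ?thesis by (simp add: c T_E)
    qed
    show "T (\<rho> h v) = \<rho> (s h) (T v)" if h: "h \<in> carrier G" for h v
    proof -
      obtain c where c: "v = E c" using E_surj by metis
      have one: "s \<one> = \<one>"
        by (metis l_one one_closed r_one s_closed s_mult s_s)
      have inv: "s (inv h) = inv (s h)"
        using h by (metis inv_closed inv_equality l_inv one s_closed s_mult)
      have "T (\<rho> h v) = E (\<lambda>g. c (inv h \<otimes> s g))"
        using h by (simp add: c E_def act_orbit_comb T_E[unfolded E_def])
      also have "\<dots> = E (\<lambda>g. c (s (inv (s h) \<otimes> g)))"
        unfolding E_def orbit_comb_def
        using h by (intro sum.cong) (auto simp: s_mult s_closed s_s inv[symmetric])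
      also have "\<dots> = \<rho> (s h) (T v)"
        using h by (simp add: c T_E) (simp add: E_def act_orbit_comb s_closed)
      finally show ?thesis .
    qed
  qed
qed

end

text \<open>
  The involution \<open>T\<close> serves as the action of \<open>\<sigma>\<close>. It satisfies the relations that define the
  symmetric group as a semidirect product of the alternating group with the group generated by
  \<open>\<sigma>\<close>: its square is the identity, and it conjugates \<open>g\<close> to \<open>\<sigma> g \<sigma>\<close>.
\<close>

lemma extends_to_sym_of_twist:
  assumes module: "group_module (alt_group n) scale \<rho>"
    and \<sigma>: "\<sigma> permutes {1..n}" "\<not> evenperm \<sigma>" "\<sigma> \<circ> \<sigma> = id"
    and lin: "Vector_Spaces.linear scale scale T" and TT: "\<And>v. T (T v) = v"
    and twist: "\<And>g v. g \<in> carrier (alt_group n) \<Longrightarrow> T (\<rho> g v) = \<rho> (\<sigma> \<circ> g \<circ> \<sigma>) (T v)"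
  shows "extends_to_sym n scale \<rho>"
proof -
  interpret group_module "alt_group n" scale \<rho> by (fact module)
  define \<tau> where "\<tau> g = (if evenperm g then \<rho> g else \<rho> (g \<circ> \<sigma>) \<circ> T)" for g
  have mult: "\<rho> (g \<circ> h) v = \<rho> g (\<rho> h v)"
    if "g \<in> carrier (alt_group n)" "h \<in> carrier (alt_group n)" for g h v
    using act_mult[OF that] by (simp add: alt_group_mult)
  have perm: "permutation g" if "g permutes {1..n}" for g
    using that by (auto simp: permutation_permutes)
  have odd: "g \<circ> \<sigma> \<in> carrier (alt_group n)" if "g permutes {1..n}" "\<not> evenperm g" for g
    using that \<sigma> perm by (simp add: alt_group_carrier permutes_compose evenperm_comp)
  have conj: "\<sigma> \<circ> g \<circ> \<sigma> \<in> carrier (alt_group n)" if "g \<in> carrier (alt_group n)" for g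
    using that \<sigma> perm
    by (simp add: alt_group_carrier permutes_compose evenperm_comp permutation_compose)
  have odd': "\<sigma> \<circ> g \<in> carrier (alt_group n)" if "g permutes {1..n}" "\<not> evenperm g" for g
    using that \<sigma> perm by (simp add: alt_group_carrier permutes_compose evenperm_comp)
  have \<sigma>\<sigma>: "\<sigma> (\<sigma> x) = x" for x using \<sigma>(3) by (metis comp_apply id_apply)
  have \<tau>_mult: "\<tau> (g \<circ> h) = \<tau> g \<circ> \<tau> h"
    if g: "g permutes {1..n}" and h: "h permutes {1..n}" for g h
  proof -
    have even: "evenperm (g \<circ> h) \<longleftrightarrow> (evenperm g \<longleftrightarrow> evenperm h)"
      using g h perm by (simp add: evenperm_comp)
    consider "evenperm g" "evenperm h" | "evenperm g" "\<not> evenperm h"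
      | "\<not> evenperm g" "evenperm h" | "\<not> evenperm g" "\<not> evenperm h" by blast
    then show ?thesis
    proof cases
      case 1
      then show ?thesis using even g h mult[of g h]
        by (simp add: \<tau>_def fun_eq_iff alt_group_carrier)
    next
      case 2
      then show ?thesis using even g h mult[of g "h \<circ> \<sigma>"] odd[OF h]
        by (simp add: \<tau>_def fun_eq_iff alt_group_carrier comp_assoc)
    next
      case 3
      have "g \<circ> h \<circ> \<sigma> = (g \<circ> \<sigma>) \<circ> (\<sigma> \<circ> h \<circ> \<sigma>)" by (simp add: fun_eq_iff \<sigma>\<sigma>)
      moreover have "h \<in> carrier (alt_group n)" using h 3 by (simp add: alt_group_carrier)
      ultimately have "\<rho> (g \<circ> h \<circ> \<sigma>) v = \<rho> (g \<circ> \<sigma>) (\<rho> (\<sigma> \<circ> h \<circ> \<sigma>) v)" for v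
        using mult[OF odd[OF g] conj[of h]] 3 by simp
      then show ?thesis using 3 even \<open>h \<in> carrier (alt_group n)\<close>
        by (simp add: \<tau>_def fun_eq_iff twist)
    next
      case 4
      have "g \<circ> h = (g \<circ> \<sigma>) \<circ> (\<sigma> \<circ> (h \<circ> \<sigma>) \<circ> \<sigma>)" by (simp add: fun_eq_iff \<sigma>\<sigma>)
      then have "\<rho> (g \<circ> h) v = \<rho> (g \<circ> \<sigma>) (\<rho> (\<sigma> \<circ> (h \<circ> \<sigma>) \<circ> \<sigma>) v)" for v
        using mult[OF odd[OF g] conj[OF odd[OF h]]] 4 by simp
      then show ?thesis using 4 even odd[OF h]
        by (simp add: \<tau>_def fun_eq_iff twist TT)
    qed
  qed
  have bij_T: "bij T" by (rule o_bij[of T]) (simp_all add: fun_eq_iff TT)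
  have bij_\<rho>: "bij (\<rho> g)" if "g \<in> carrier (alt_group n)" for g
    using bij_prop0[OF that] by (simp add: Bij_def)
  have bij_\<tau>: "bij (\<tau> g)" if "g permutes {1..n}" for g
    using that odd[OF that] bij_T bij_\<rho>
    by (auto simp: \<tau>_def alt_group_carrier intro!: bij_comp)
  have lin_\<tau>: "Vector_Spaces.linear scale scale (\<tau> g)" if "g permutes {1..n}" for g
    using that odd[OF that] linear_action Vector_Spaces.linear_compose[OF lin linear_action]
    by (auto simp: \<tau>_def alt_group_carrier)
  have "group_hom (sym_group n) (BijGroup UNIV) \<tau>"
  proof (intro group_hom.intro group_hom_axioms.intro group_BijGroup homI sym_group_is_group)
    show "\<tau> g \<in> carrier (BijGroup UNIV)" if "g \<in> carrier (sym_group n)" for g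
      using bij_\<tau> that by (simp add: BijGroup_def Bij_def sym_group_carrier)
    show "\<tau> (g \<otimes>\<^bsub>sym_group n\<^esub> h) = \<tau> g \<otimes>\<^bsub>BijGroup UNIV\<^esub> \<tau> h"
      if "g \<in> carrier (sym_group n)" "h \<in> carrier (sym_group n)" for g h
      using that bij_\<tau> \<tau>_mult
      by (simp add: BijGroup_def Bij_def sym_group_carrier sym_group_mult compose_def fun_eq_iff)
  qed
  then have "group_module (sym_group n) scale \<tau>"
    by (intro group_module.intro group_action.intro group_module_axioms.intro vector_space_axioms)
       (simp_all add: lin_\<tau> sym_group_carrier)
  moreover have "group_module_iso (alt_group n) scale \<tau> scale \<rho> id"
    by (auto simp: group_module_iso_def linear_id \<tau>_def alt_group_carrier)
  ultimately show ?thesis unfolding extends_to_sym_def by blast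
qed

section \<open>Joint eigenvectors of commuting elements of order three\<close>

context vector_space
begin

text \<open>
  To remove one vector \<open>v b\<close> from a linear relation, apply \<open>f i - e i b\<close>; the other coefficients are
  multiplied by \<open>e i a - e i b\<close>, which is nonzero for a suitable \<open>i\<close>.
\<close>

lemma separated_eigenvectors_coeff_0:
  assumes "finite A"
    and "\<And>a. a \<in> A \<Longrightarrow> v a \<noteq> 0"
    and lin: "\<And>i. i \<in> I \<Longrightarrow> Vector_Spaces.linear scale scale (f i)"
    and "\<And>i a. i \<in> I \<Longrightarrow> a \<in> A \<Longrightarrow> f i (v a) = scale (e i a) (v a)"
    and "\<And>a b. a \<in> A \<Longrightarrow> b \<in> A \<Longrightarrow> a \<noteq> b \<Longrightarrow> \<exists>i\<in>I. e i a \<noteq> e i b"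
    and "(\<Sum>a\<in>A. scale (c a) (v a)) = 0" and "a \<in> A"
  shows "c a = 0"
  using assms(1,2,4-)
proof (induction A arbitrary: c a rule: finite_induct)
  case empty
  then show ?case by simp
next
  case (insert b A)
  have c_0: "c x = 0" if x: "x \<in> A" for x
  proof -
    obtain i where i: "i \<in> I" "e i x \<noteq> e i b"
      using insert.prems(3)[of x b] insert.hyps x by fastforce
    interpret f: Vector_Spaces.linear scale scale "f i" by (rule lin[OF i(1)])
    have "(\<Sum>a\<in>A. scale (c a * (e i a - e i b)) (v a))
        = (\<Sum>a\<in>insert b A. scale (c a * (e i a - e i b)) (v a))"
      using insert.hyps by simp
    also have "\<dots> = (\<Sum>a\<in>insert b A. scale (c a) (f i (v a)) - scale (e i b) (scale (c a) (v a)))"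
    proof (rule sum.cong[OF refl])
      fix a assume "a \<in> insert b A"
      then have "f i (v a) = scale (e i a) (v a)" using insert.prems(2)[OF i(1)] by blast
      then show "scale (c a * (e i a - e i b)) (v a)
          = scale (c a) (f i (v a)) - scale (e i b) (scale (c a) (v a))"
        by (simp add: algebra_simps scale_left_diff_distrib)
    qed
    also have "\<dots> = f i (\<Sum>a\<in>insert b A. scale (c a) (v a))
        - scale (e i b) (\<Sum>a\<in>insert b A. scale (c a) (v a))"
      by (simp only: sum_subtractf f.sum f.scale scale_sum_right)
    also have "\<dots> = 0" using insert.prems(4) by (simp add: f.zero)
    finally have "c x * (e i x - e i b) = 0"
      using insert.IH[of "\<lambda>a. c a * (e i a - e i b)" x] insert.prems x by auto
    then show ?thesis using i by simp
  qed
  then have "scale (c b) (v b) = 0" using insert.prems(4) insert.hyps by simp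
  then have "c b = 0" using insert.prems(1)[of b] by simp
  with c_0 insert.prems(5) show ?case by blast
qed

lemma card_separated_eigenvectors_le_dim:
  assumes fin: "finite A"
    and nz: "\<And>a. a \<in> A \<Longrightarrow> v a \<noteq> 0"
    and lin: "\<And>i. i \<in> I \<Longrightarrow> Vector_Spaces.linear scale scale (f i)"
    and eig: "\<And>i a. i \<in> I \<Longrightarrow> a \<in> A \<Longrightarrow> f i (v a) = scale (e i a) (v a)"
    and sep: "\<And>a b. a \<in> A \<Longrightarrow> b \<in> A \<Longrightarrow> a \<noteq> b \<Longrightarrow> \<exists>i\<in>I. e i a \<noteq> e i b"
    and B: "finite B" "span B = UNIV"
  shows "card A \<le> dim (UNIV :: 'b set)"
proof -
  have inj: "inj_on v A"
  proof (rule inj_onI, rule ccontr)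
    fix a b assume ab: "a \<in> A" "b \<in> A" "v a = v b" "a \<noteq> b"
    then obtain i where i: "i \<in> I" "e i a \<noteq> e i b" using sep by blast
    have "scale (e i a) (v a) = scale (e i b) (v a)"
      using eig[OF i(1) ab(1)] eig[OF i(1) ab(2)] ab(3) by metis
    then show False using i nz[OF ab(1)] by (metis scale_cancel_right)
  qed
  have indep: "independent (v ` A)"
  proof (rule independent_if_scalars_zero)
    fix c x assume "(\<Sum>x\<in>v ` A. scale (c x) x) = 0" and x: "x \<in> v ` A"
    then have "(\<Sum>a\<in>A. scale (c (v a)) (v a)) = 0" by (simp add: sum.reindex[OF inj])
    from separated_eigenvectors_coeff_0[of A v I f e "\<lambda>a. c (v a)", OF fin nz lin eig sep this] x
    show "c x = 0" by auto
  qed (simp add: fin)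
  obtain C where C: "independent C" "UNIV \<subseteq> span C" "card C = dim (UNIV :: 'b set)"
    using basis_exists[of UNIV] by metis
  have "finite C" using independent_span_bound[OF B(1) C(1)] B(2) by simp
  then have "card (v ` A) \<le> card C" using independent_span_bound[OF _ indep] C(2) by blast
  then show ?thesis using C(3) card_image[OF inj] by simp
qed

end

lemma primitive_cube_root:
  assumes two: "(1::'a::field) + 1 = 0" and \<omega>: "\<omega> ^ 2 + \<omega> + 1 = (0::'a)"
  shows "\<omega> ^ 3 = 1" "\<omega> \<noteq> 1" "\<omega> ^ 2 \<noteq> 1" "\<omega> ^ 2 \<noteq> \<omega>"
proof -
  have "\<omega> ^ 3 - 1 = (\<omega> - 1) * (\<omega> ^ 2 + \<omega> + 1)"
    by (simp add: algebra_simps power2_eq_square power3_eq_cube)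
  then show "\<omega> ^ 3 = 1" using \<omega> by simp
  have dbl: "a + a = 0" for a :: 'a using distrib_left[of a 1 1] two by simp
  show "\<omega> \<noteq> 1" using \<omega> two by auto
  show "\<omega> ^ 2 \<noteq> 1"
  proof
    assume "\<omega> ^ 2 = 1"
    then have "\<omega> + (1 + 1) = 0" using \<omega> by (simp add: algebra_simps)
    then have "\<omega> = 0" by (simp only: two add_0_right)
    then show False using \<omega> by simp
  qed
  show "\<omega> ^ 2 \<noteq> \<omega>" using \<omega> dbl[of \<omega>] by auto
qed

context group_module
begin

text \<open>
  For \<open>t\<close> of order three and \<open>l ^ 3 = 1\<close> this is the projection onto the \<open>l\<close>-eigenspace of \<open>t\<close>, as
  \<open>l\<^sup>2\<close> and \<open>l\<close> are the inverses of \<open>l\<close> and \<open>l\<^sup>2\<close>; the usual factor \<open>1/3\<close> is \<open>1\<close> in characteristic 2.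
\<close>

definition eigenproj :: "'a \<Rightarrow> 'g \<Rightarrow> 'v \<Rightarrow> 'v" where
  "eigenproj l t v = v + scale (l ^ 2) (\<rho> t v) + scale l (\<rho> t (\<rho> t v))"

lemma linear_eigenproj:
  assumes t: "t \<in> carrier G"
  shows "Vector_Spaces.linear scale scale (eigenproj l t)"
  by (intro Vector_Spaces.linear_iff_module_hom[THEN iffD2] module_hom.intro
        module_hom_axioms.intro module_axioms)
     (simp_all add: eigenproj_def t act_add act_scale scale_right_distrib algebra_simps)

lemma eigenproj_commute:
  assumes "a \<in> carrier G" "t \<in> carrier G" "a \<otimes> t = t \<otimes> a"
  shows "eigenproj l t (\<rho> a v) = \<rho> a (eigenproj l t v)"
proof -
  have "\<rho> t (\<rho> a v) = \<rho> a (\<rho> t v)" for v using assms by (metis act_mult)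
  then show ?thesis using assms by (simp add: eigenproj_def act_add act_scale)
qed

lemma act_eigenproj:
  assumes t: "t \<in> carrier G" "t \<otimes> (t \<otimes> t) = \<one>" and l: "l ^ 3 = 1"
  shows "\<rho> t (eigenproj l t v) = scale l (eigenproj l t v)"
proof -
  interpret Group.group G by (rule group_G)
  have "\<rho> t (\<rho> t (\<rho> t v)) = v" using t by (simp add: act_mult[symmetric] act_one)
  moreover have "l * l ^ 2 = 1" using l by (simp add: power3_eq_cube power2_eq_square mult.assoc)
  ultimately show ?thesis using t
    by (simp add: eigenproj_def act_add act_scale scale_right_distrib power2_eq_square algebra_simps)
qed

lemma add_self:
  fixes v :: 'v
  assumes "(1::'a) + 1 = 0"
  shows "v + v = 0"
  using scale_left_distrib[of 1 1 v] assms by simp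

lemma eigenproj_eigenvector:
  assumes two: "(1::'a) + 1 = 0" and t: "t \<in> carrier G" and l: "l ^ 3 = 1"
    and v: "\<rho> t v = scale l v"
  shows "eigenproj l t v = v"
proof -
  have "l * l ^ 2 = 1" using l by (simp add: power3_eq_cube power2_eq_square mult.assoc)
  then show ?thesis using t add_self[OF two, of v]
    by (simp add: eigenproj_def v act_scale mult.commute power2_eq_square)
qed

text \<open>
  The sum of the two eigenprojections is \<open>t + t\<^sup>2\<close>, because \<open>\<omega>\<^sup>2 + \<omega> = 1\<close> in characteristic 2. If \<open>v\<close> has
  no component in the nontrivial eigenspaces, then \<open>t v = t\<^sup>2 v\<close>, hence \<open>t v = v\<close>.
\<close>

lemma fixed_of_eigenproj_0:
  assumes two: "(1::'a) + 1 = 0" and \<omega>: "\<omega> ^ 2 + \<omega> + 1 = 0"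
    and t: "t \<in> carrier G" "t \<otimes> (t \<otimes> t) = \<one>"
    and 0: "eigenproj \<omega> t v = 0" "eigenproj (\<omega> ^ 2) t v = 0"
  shows "\<rho> t v = v"
proof -
  interpret Group.group G by (rule group_G)
  have \<omega>2: "\<omega> ^ 2 + \<omega> = 1"
    using \<omega> two by (metis add_right_cancel)
  have "\<omega> ^ 3 = 1" by (rule primitive_cube_root[OF two \<omega>])
  then have \<omega>4: "(\<omega> ^ 2) ^ 2 = \<omega>" by (simp add: power2_eq_square power3_eq_cube mult.assoc)
  have "eigenproj \<omega> t v + eigenproj (\<omega> ^ 2) t v
      = (v + v) + scale (\<omega> ^ 2 + \<omega>) (\<rho> t v) + scale (\<omega> ^ 2 + \<omega>) (\<rho> t (\<rho> t v))"
    unfolding eigenproj_def \<omega>4 by (simp add: scale_left_distrib algebra_simps)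
  then have "\<rho> t v + \<rho> t (\<rho> t v) = 0" by (simp add: 0 \<omega>2 add_self[OF two])
  then have "\<rho> t (\<rho> t (\<rho> t v) + \<rho> t (\<rho> t (\<rho> t v))) = 0"
    using t by (simp add: act_zero act_add[symmetric])
  moreover have "\<rho> t (\<rho> t (\<rho> t v)) = v" using t by (simp add: act_mult[symmetric] act_one)
  ultimately have "v + \<rho> t v = 0" using t by (simp add: act_add)
  then show ?thesis using add_self[OF two, of v] by (metis add_left_cancel)
qed

text \<open>
  The product of the eigenprojections. The third property says that its values lie in the joint
  eigenspace.
\<close>

lemma joint_eigenprojection:
  fixes k :: nat
  assumes two: "(1::'a) + 1 = 0"
    and t: "\<And>i. i < k \<Longrightarrow> t i \<in> carrier G" "\<And>i. i < k \<Longrightarrow> t i \<otimes> (t i \<otimes> t i) = \<one>"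
    and comm: "\<And>i j. i < k \<Longrightarrow> j < k \<Longrightarrow> t i \<otimes> t j = t j \<otimes> t i"
    and l: "\<And>i. i < k \<Longrightarrow> l i ^ 3 = 1"
  obtains p where "Vector_Spaces.linear scale scale p"
    "\<And>v. (\<And>i. i < k \<Longrightarrow> \<rho> (t i) v = scale (l i) v) \<Longrightarrow> p v = v"
    "\<And>i v. i < k \<Longrightarrow> \<rho> (t i) (p v) = scale (l i) (p v)"
    "\<And>a v. a \<in> carrier G \<Longrightarrow> (\<And>i. i < k \<Longrightarrow> a \<otimes> t i = t i \<otimes> a) \<Longrightarrow> p (\<rho> a v) = \<rho> a (p v)"
  using t comm l
proof (induction k arbitrary: thesis)
  case 0
  show ?case by (rule "0.prems"(1)[of id]) (simp_all add: linear_id[unfolded id_def])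
next
  case (Suc k)
  obtain p where lin: "Vector_Spaces.linear scale scale p"
    and eig_fixed: "\<And>v. (\<And>i. i < k \<Longrightarrow> \<rho> (t i) v = scale (l i) v) \<Longrightarrow> p v = v"
    and eig: "\<And>i v. i < k \<Longrightarrow> \<rho> (t i) (p v) = scale (l i) (p v)"
    and comm: "\<And>a v. a \<in> carrier G \<Longrightarrow> (\<And>i. i < k \<Longrightarrow> a \<otimes> t i = t i \<otimes> a)
      \<Longrightarrow> p (\<rho> a v) = \<rho> a (p v)"
    by (rule Suc.IH) (use Suc.prems in auto)
  define q where "q = eigenproj (l k) (t k)"
  interpret q: Vector_Spaces.linear scale scale q
    unfolding q_def by (rule linear_eigenproj) (simp add: Suc.prems)
  show ?case
  proof (rule Suc.prems(1))
    show "Vector_Spaces.linear scale scale (q \<circ> p)"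
      using lin q.linear_axioms by (rule Vector_Spaces.linear_compose)
    show "(q \<circ> p) v = v" if "\<And>i. i < Suc k \<Longrightarrow> \<rho> (t i) v = scale (l i) v" for v
      using that by (simp add: q_def eig_fixed Suc.prems eigenproj_eigenvector[OF two])
    show "\<rho> (t i) ((q \<circ> p) v) = scale (l i) ((q \<circ> p) v)" if "i < Suc k" for i v
    proof (cases "i = k")
      case True
      then show ?thesis by (simp add: q_def Suc.prems act_eigenproj)
    next
      case False
      then have "i < k" using that by simp
      then have "q (\<rho> (t i) (p v)) = \<rho> (t i) (q (p v))"
        unfolding q_def by (intro eigenproj_commute) (simp_all add: Suc.prems)
      then show ?thesis using \<open>i < k\<close> by (simp add: eig q.scale)
    qed
    show "(q \<circ> p) (\<rho> a v) = \<rho> a ((q \<circ> p) v)"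
      if "a \<in> carrier G" "\<And>i. i < Suc k \<Longrightarrow> a \<otimes> t i = t i \<otimes> a" for a v
      using that by (simp add: comm q_def eigenproj_commute Suc.prems)
  qed
qed

end

section \<open>Block three-cycles\<close>

text \<open>
  The block structure is carried by a permutation \<open>f\<close>: its \<open>i\<close>-th block is the image under \<open>f\<close> of the
  \<open>i\<close>-th standard block. Conjugation of block three-cycles then becomes composition with \<open>f\<close>, and
  all systems of blocks form one regular orbit of the symmetric group.
\<close>

definition block_cycle :: "(nat \<Rightarrow> nat) \<Rightarrow> nat \<Rightarrow> nat \<Rightarrow> nat" where
  "block_cycle f i = three_cycle (f (3 * i + 1)) (f (3 * i + 2)) (f (3 * i + 3))"

lemma distinct_block: "inj f \<Longrightarrow> distinct [f (3 * i + 1), f (3 * i + 2), f (3 * i + 3 :: nat)]"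
  by (simp add: inj_eq)

lemma block_cycle_alt:
  assumes f: "f permutes {1..n}" and i: "i < n div 3"
  shows "block_cycle f i \<in> carrier (alt_group n)"
proof -
  have "{3 * i + 1, 3 * i + 2, 3 * i + 3} \<subseteq> {1..n}" using i by auto
  then have "f (3 * i + 1) \<in> {1..n}" "f (3 * i + 2) \<in> {1..n}" "f (3 * i + 3) \<in> {1..n}"
    using permutes_in_image[OF f] by auto
  moreover have "distinct [f (3 * i + 1), f (3 * i + 2), f (3 * i + 3)]"
    using distinct_block[OF permutes_inj[OF f]] .
  ultimately show ?thesis
    unfolding alt_group_carrier block_cycle_def
    by (intro conjI three_cycle_permutes evenperm_three_cycle) auto
qed

lemma block_cycle_cube:
  "inj f \<Longrightarrow> block_cycle f i \<circ> (block_cycle f i \<circ> block_cycle f i) = id"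
  unfolding block_cycle_def by (rule three_cycle_cube[OF distinct_block])

lemma block_cycle_conj: "inj g \<Longrightarrow> g \<circ> block_cycle f i = block_cycle (g \<circ> f) i \<circ> g"
  by (simp add: block_cycle_def three_cycle_conj)

lemma comp_block_cycle_commute:
  assumes "inj g" "\<And>x. x \<in> {3 * i + 1..3 * i + 3} \<Longrightarrow> g (f x) = f x"
  shows "g \<circ> block_cycle f i = block_cycle f i \<circ> g"
  unfolding block_cycle_def using assms by (intro comp_three_cycle_commute) auto

lemma block_cycle_commute:
  assumes f: "inj f"
  shows "block_cycle f i \<circ> block_cycle f j = block_cycle f j \<circ> block_cycle f i"
proof (cases "i = j")
  case False
  have "inj (block_cycle f i)"
    using block_cycle_cube[OF f, of i] by (metis inj_on_id inj_on_imageI2)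
  moreover have "block_cycle f i (f x) = f x" if "x \<in> {3 * j + 1..3 * j + 3}" for x
  proof -
    have "x \<notin> {3 * i + 1, 3 * i + 2, 3 * i + 3}" using that False by auto
    then show ?thesis unfolding block_cycle_def using f by (intro three_cycle_fixes) (simp add: inj_eq)
  qed
  ultimately show ?thesis by (rule comp_block_cycle_commute)
qed simp

lemma permutes_extend_three:
  assumes "a \<in> Z" "b \<in> Z" "c \<in> Z" "p \<in> Z" "q \<in> Z" "r \<in> Z"
    and "distinct [a, b, c]" "distinct [p, q, r]"
  obtains h where "h permutes Z" "h p = a" "h q = b" "h r = c"
proof -
  define h1 where "h1 = transpose p a"
  define h2 where "h2 = transpose (h1 q) b \<circ> h1"
  define h3 where "h3 = transpose (h2 r) c \<circ> h2"
  have h1: "h1 permutes Z" "h1 p = a"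
    using assms by (auto simp: h1_def permutes_swap_id)
  then have q: "h1 q \<in> Z" "h1 q \<noteq> a"
    using assms permutes_in_image[OF h1(1)] permutes_inj[OF h1(1)] by (auto simp: inj_eq)
  have h2: "h2 permutes Z" unfolding h2_def
    by (intro permutes_compose h1 permutes_swap_id q assms)
  have h2_pq: "h2 p = a" "h2 q = b" using q h1 assms by (auto simp: h2_def transpose_def)
  have r: "h2 r \<in> Z" "h2 r \<noteq> a" "h2 r \<noteq> b"
    using assms h2_pq permutes_in_image[OF h2] permutes_inj[OF h2] by (auto simp: inj_eq)
  show ?thesis
  proof
    show "h3 permutes Z" unfolding h3_def
      by (intro permutes_compose h2 permutes_swap_id r assms)
    show "h3 p = a" "h3 q = b" "h3 r = c"
      using h2_pq r assms by (auto simp: h3_def transpose_def)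
  qed
qed

lemma block_arith [simp]:
  "Suc (3 * i) div 3 = i" "Suc (Suc (3 * i)) div 3 = i" "Suc (Suc (3 * i)) mod 3 = 2"
  by presburger+

definition permute_blocks :: "(nat \<Rightarrow> nat) \<Rightarrow> nat \<Rightarrow> nat" where
  "permute_blocks \<pi> x = (if x = 0 then 0 else 3 * \<pi> ((x - 1) div 3) + (x - 1) mod 3 + 1)"

definition flip_blocks :: "nat set \<Rightarrow> nat \<Rightarrow> nat" where
  "flip_blocks E x = (if (x - 1) div 3 \<notin> E then x
     else if x mod 3 = 1 then x + 1 else if x mod 3 = 2 then x - 1 else x)"

lemma permutesI_inverse:
  assumes "\<And>x. p (q x) = x" "\<And>x. q (p x) = x" "\<And>x. x \<notin> S \<Longrightarrow> p x = x"
  shows "p permutes S"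
  unfolding permutes_def using assms by metis

lemma permute_blocks_permutes:
  assumes \<pi>: "\<pi> permutes {..<n div 3}"
  shows "permute_blocks \<pi> permutes {1..n}"
proof (rule permutesI_inverse)
  have aux: "permute_blocks \<alpha> (permute_blocks \<beta> x) = x" if "\<And>i. \<alpha> (\<beta> i) = i" for \<alpha> \<beta> x
    using that by (simp add: permute_blocks_def)
  show "permute_blocks \<pi> (permute_blocks (inv' \<pi>) x) = x"
    "permute_blocks (inv' \<pi>) (permute_blocks \<pi> x) = x" for x
    using permutes_inverses[OF \<pi>] by (simp_all add: aux)
  show "permute_blocks \<pi> x = x" if "x \<notin> {1..n}" for x
  proof (cases "x = 0")
    case False
    then have "n div 3 \<le> (x - 1) div 3" using that by (intro div_le_mono) auto
    then have "\<pi> ((x - 1) div 3) = (x - 1) div 3" using permutes_not_in[OF \<pi>] by simp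
    then show ?thesis using False by (simp add: permute_blocks_def)
  qed (simp add: permute_blocks_def)
qed

lemma permute_blocks_at:
  "permute_blocks \<pi> (3 * i + 1) = 3 * \<pi> i + 1"
  "permute_blocks \<pi> (3 * i + 2) = 3 * \<pi> i + 2"
  "permute_blocks \<pi> (3 * i + 3) = 3 * \<pi> i + 3"
  by (simp_all add: permute_blocks_def)

lemma block_cycle_permute_blocks:
  "block_cycle (f \<circ> permute_blocks \<pi>) i = block_cycle f (\<pi> i)"
  by (simp only: block_cycle_def comp_def permute_blocks_at)

lemma flip_blocks_at:
  "i \<in> E \<Longrightarrow> flip_blocks E (3 * i + 1) = 3 * i + 2"
  "i \<in> E \<Longrightarrow> flip_blocks E (3 * i + 2) = 3 * i + 1"
  "flip_blocks E (3 * i + 3) = 3 * i + 3"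
  "i \<notin> E \<Longrightarrow> flip_blocks E (3 * i + 1) = 3 * i + 1"
  "i \<notin> E \<Longrightarrow> flip_blocks E (3 * i + 2) = 3 * i + 2"
  by (simp_all add: flip_blocks_def)

lemma block_cases:
  obtains "x = 0" | i where "x = 3 * i + 1" | i where "x = 3 * i + 2" | i where "x = 3 * i + (3::nat)"
proof -
  have "x = 0 \<or> (\<exists>i. x = 3 * i + 1 \<or> x = 3 * i + 2 \<or> x = 3 * i + 3)" by presburger
  then show ?thesis using that by blast
qed

lemma flip_blocks_permutes:
  assumes E: "E \<subseteq> {..<n div 3}"
  shows "flip_blocks E permutes {1..n}"
proof (rule permutesI_inverse)
  show "flip_blocks E (flip_blocks E x) = x" for x
    by (cases x rule: block_cases) (simp_all add: flip_blocks_def)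
  then show "flip_blocks E (flip_blocks E x) = x" for x .
  show "flip_blocks E x = x" if "x \<notin> {1..n}" for x
  proof (cases "x = 0")
    case False
    then have "n div 3 \<le> (x - 1) div 3" using that by (intro div_le_mono) auto
    then show ?thesis using E by (auto simp: flip_blocks_def)
  qed (simp add: flip_blocks_def)
qed

lemma block_cycle_flip_blocks:
  "block_cycle (f \<circ> flip_blocks E) i =
    (if i \<in> E then three_cycle (f (3 * i + 2)) (f (3 * i + 1)) (f (3 * i + 3)) else block_cycle f i)"
  unfolding block_cycle_def comp_def
  by (cases "i \<in> E")
    (simp_all only: flip_blocks_at if_True if_False not_True_eq_False simp_thms)

lemma flip_first_block_odd: "\<not> evenperm (flip_blocks {0})"
proof -
  have "flip_blocks {0} x = transpose 1 2 x" for x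
    by (cases x rule: block_cases)
      (auto simp: flip_blocks_def transpose_def)
  then have "flip_blocks {0} = transpose 1 2" by blast
  then show ?thesis by (simp add: evenperm_swap)
qed

text \<open>
  Used to move the support of a weight to any other set of blocks of the same size.
\<close>

lemma exists_permutes_vimage:
  assumes S: "S \<subseteq> {..<r::nat}" "S' \<subseteq> {..<r}" "card S = card S'"
  obtains \<pi> where "\<pi> permutes {..<r}" "\<pi> -` S' = S"
proof -
  have fin: "finite S" "finite S'" using S finite_subset by blast+
  obtain b where b: "bij_betw b S S'" using finite_same_card_bij[OF fin S(3)] by blast
  have "card ({..<r} - S) = card ({..<r} - S')" using S fin by (simp add: card_Diff_subset)
  then obtain b' where b': "bij_betw b' ({..<r} - S) ({..<r} - S')"
    using finite_same_card_bij[of "{..<r} - S" "{..<r} - S'"] by auto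
  define \<pi> where "\<pi> x = (if x \<in> S then b x else if x < r then b' x else x)" for x
  have 1: "bij_betw \<pi> S S'" using b by (rule bij_betw_cong[THEN iffD1, rotated]) (simp add: \<pi>_def)
  have 2: "bij_betw \<pi> ({..<r} - S) ({..<r} - S')"
    using b' by (rule bij_betw_cong[THEN iffD1, rotated]) (simp add: \<pi>_def)
  have "bij_betw \<pi> (S \<union> ({..<r} - S)) (S' \<union> ({..<r} - S'))"
    using 1 2 by (rule bij_betw_combine) blast
  moreover have "S \<union> ({..<r} - S) = {..<r}" "S' \<union> ({..<r} - S') = {..<r}" using S by auto
  ultimately have \<pi>: "\<pi> permutes {..<r}"
    using S(1) by (intro bij_imp_permutes) (auto simp: \<pi>_def)
  have "\<pi> x \<in> S' \<longleftrightarrow> x \<in> S" for x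
  proof (cases "x < r")
    case True
    then show ?thesis using bij_betwE[OF 1] bij_betwE[OF 2] by auto
  next
    case False
    then show ?thesis using S by (auto simp: \<pi>_def)
  qed
  then show ?thesis using that \<pi> by blast
qed

text \<open>
  The binomial coefficient is at least \<open>(r / (r - k)) ^ (r - k)\<close>, where \<open>r / (r - k) \<ge> 2\<close>.
\<close>

lemma two_power_le_binomial:
  assumes "k \<le> r" "r \<le> 2 * k"
  shows "2 ^ r \<le> (r choose k) * 2 ^ k"
proof -
  have "2 ^ (r - k) \<le> (r choose (r - k))"
  proof (cases "r = k")
    case False
    then have pos: "0 < r - k" using assms by simp
    have "(2::real) \<le> real r / real (r - k)"
      using pos assms by (simp add: field_simps of_nat_diff)
    then have "(2::real) ^ (r - k) \<le> (real r / real (r - k)) ^ (r - k)"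
      by (rule power_mono) simp
    also have "\<dots> \<le> real (r choose (r - k))"
      by (rule binomial_ge_n_over_k_pow_k) simp
    finally show ?thesis by (metis of_nat_le_iff of_nat_numeral of_nat_power)
  qed simp
  then have "2 ^ (r - k) * 2 ^ k \<le> (r choose k) * 2 ^ k"
    using binomial_symmetric[OF assms(1)] by simp
  then show ?thesis using assms(1) by (simp add: power_add[symmetric])
qed

section \<open>Weights of a module for the alternating group\<close>

locale alt_irreducible = irreducible_group_module "alt_group n" scale \<rho>
  for n :: nat
    and scale :: "'a::field \<Rightarrow> 'v::ab_group_add \<Rightarrow> 'v"
    and \<rho> :: "(nat \<Rightarrow> nat) \<Rightarrow> 'v \<Rightarrow> 'v" +
  fixes \<omega> :: 'a
  assumes two: "(1::'a) + 1 = 0" and \<omega>: "\<omega> ^ 2 + \<omega> + 1 = 0"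
begin

lemmas cube_root = primitive_cube_root[OF two \<omega>]

lemma finite_alt: "finite (carrier (alt_group n))"
  using finite_permutations[of "{1..n}"] by (rule rev_finite_subset) (auto simp: alt_group_carrier)

lemma act_comp:
  "g \<in> carrier (alt_group n) \<Longrightarrow> h \<in> carrier (alt_group n) \<Longrightarrow> \<rho> (g \<circ> h) v = \<rho> g (\<rho> h v)"
  using act_mult by (simp add: alt_group_mult)

lemma comp_alt:
  "g \<in> carrier (alt_group n) \<Longrightarrow> h \<in> carrier (alt_group n) \<Longrightarrow> g \<circ> h \<in> carrier (alt_group n)"
  using monoid.m_closed[OF group.is_monoid[OF alt_group_is_group]] by (simp add: alt_group_mult)

lemma act_id: "\<rho> id v = v"
  using act_one by (simp add: alt_group_one)

text \<open>
  A weight is encoded by its support \<open>S\<close> and the subset \<open>Q\<close> of \<open>S\<close> where the eigenvalue is \<open>\<omega>\<close>.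
\<close>

definition eigval :: "nat set \<Rightarrow> nat set \<Rightarrow> nat \<Rightarrow> 'a" where
  "eigval S Q i = (if i \<in> Q then \<omega> else if i \<in> S then \<omega> ^ 2 else 1)"

lemma eigval_cube: "eigval S Q i ^ 3 = 1"
proof -
  have "(\<omega> ^ 2) ^ 3 = (\<omega> ^ 3) ^ 2" by (simp only: power_mult[symmetric] mult.commute)
  then show ?thesis using cube_root by (simp add: eigval_def)
qed

definition weight :: "(nat \<Rightarrow> nat) \<Rightarrow> nat set \<Rightarrow> nat set \<Rightarrow> bool" where
  "weight f S Q \<longleftrightarrow>
    (\<exists>v. v \<noteq> 0 \<and> (\<forall>i < n div 3. \<rho> (block_cycle f i) v = scale (eigval S Q i) v))"

text \<open>
  The first \<open>k\<close> block three-cycles of \<open>f\<close> act on \<open>v\<close> by nontrivial eigenvalues. Zero vectors are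
  included, so for a fixed permutation \<open>f\<close> and fixed \<open>Q\<close> these vectors form the joint
  eigenspace \<open>U\<close> of the outline.
\<close>

definition depth_vector :: "nat \<Rightarrow> (nat \<Rightarrow> nat) \<Rightarrow> nat set \<Rightarrow> 'v \<Rightarrow> bool" where
  "depth_vector k f Q v \<longleftrightarrow> f permutes {1..n} \<and> 3 * k \<le> n \<and>
    (\<forall>i < k. \<rho> (block_cycle f i) v = scale (eigval {..<k} Q i) v)"

text \<open>
  This only says that depth \<open>k + 1\<close> does not occur; a nonzero vector of depth \<open>k\<close> is a separate
  hypothesis wherever one is needed.
\<close>

definition maximal_depth :: "nat \<Rightarrow> bool" where
  "maximal_depth k \<longleftrightarrow> (\<forall>f Q v. depth_vector (Suc k) f Q v \<longrightarrow> v = 0)"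

text \<open>
  A three-cycle on the remaining points with a nontrivial eigenvalue can be made the next block
  three-cycle, by changing \<open>f\<close> only on points above \<open>3 * k\<close>.
\<close>

lemma eigenvector_of_larger_depth:
  assumes v: "depth_vector k f Q v" and max: "maximal_depth k"
    and abc: "a \<in> {3 * k + 1..n}" "b \<in> {3 * k + 1..n}" "c \<in> {3 * k + 1..n}" "distinct [a, b, c]"
    and t: "t = three_cycle (f a) (f b) (f c)" "\<rho> t v = scale l v" and l: "l \<in> {\<omega>, \<omega> ^ 2}"
  shows "v = 0"
proof -
  have f: "f permutes {1..n}" using v by (simp add: depth_vector_def)
  have k: "3 * k + 3 \<le> n"
  proof -
    have "card {a, b, c} \<le> card {3 * k + 1..n}" using abc by (intro card_mono) auto
    then show ?thesis using abc(4) by simp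
  qed
  obtain h where h: "h permutes {3 * k + 1..n}"
    and h_abc: "h (3 * k + 1) = a" "h (3 * k + 2) = b" "h (3 * k + 3) = c"
    by (rule permutes_extend_three[of a "{3 * k + 1..n}" b c "3 * k + 1" "3 * k + 2" "3 * k + 3"])
      (use abc k in auto)
  have "h permutes {1..n}" by (rule permutes_subset[OF h]) auto
  then have fh: "(f \<circ> h) permutes {1..n}" by (rule permutes_compose) (rule f)
  have low: "block_cycle (f \<circ> h) i = block_cycle f i" if "i < k" for i
  proof -
    have "h x = x" if "x \<in> {3 * i + 1..3 * i + 3}" for x
      using that \<open>i < k\<close> by (intro permutes_not_in[OF h]) auto
    then show ?thesis by (simp add: block_cycle_def)
  qed
  have top: "block_cycle (f \<circ> h) k = t" by (simp only: block_cycle_def comp_def h_abc t(1))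
  define Q' where "Q' = (if l = \<omega> then insert k Q else Q - {k})"
  have "\<rho> (block_cycle (f \<circ> h) i) v = scale (eigval {..<Suc k} Q' i) v" if "i < Suc k" for i
  proof (cases "i = k")
    case True
    then show ?thesis using l t(2) by (auto simp: top eigval_def Q'_def)
  next
    case False
    then have "i < k" using that by simp
    then show ?thesis using v by (auto simp: low depth_vector_def eigval_def Q'_def)
  qed
  then have "depth_vector (Suc k) (f \<circ> h) Q' v"
    unfolding depth_vector_def using fh k by simp
  then show ?thesis using max unfolding maximal_depth_def by blast
qed

text \<open>
  The three-cycle commutes with the block three-cycles, so its eigenprojections map the joint
  eigenspace to itself; by maximality the two nontrivial ones vanish there.
\<close>

lemma tail_three_cycle_fixes:
  assumes v: "depth_vector k f Q v" and max: "maximal_depth k"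
    and abc: "a \<in> {3 * k + 1..n}" "b \<in> {3 * k + 1..n}" "c \<in> {3 * k + 1..n}" "distinct [a, b, c]"
  shows "three_cycle (f a) (f b) (f c) \<in> carrier (alt_group n)"
    and "\<rho> (three_cycle (f a) (f b) (f c)) v = v"
proof -
  define t where "t = three_cycle (f a) (f b) (f c)"
  have f: "f permutes {1..n}" using v by (simp add: depth_vector_def)
  note inj = permutes_inj[OF f]
  have "f a \<in> {1..n}" "f b \<in> {1..n}" "f c \<in> {1..n}"
    using abc permutes_in_image[OF f] by auto
  moreover have dist: "distinct [f a, f b, f c]" using abc(4) inj by (simp add: inj_eq)
  ultimately show t: "three_cycle (f a) (f b) (f c) \<in> carrier (alt_group n)"
    unfolding alt_group_carrier by (intro conjI three_cycle_permutes evenperm_three_cycle) auto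
  then have t': "t \<in> carrier (alt_group n)" by (simp add: t_def)
  have cube: "t \<otimes>\<^bsub>alt_group n\<^esub> (t \<otimes>\<^bsub>alt_group n\<^esub> t) = \<one>\<^bsub>alt_group n\<^esub>"
    using three_cycle_cube[OF dist] by (simp add: t_def alt_group_mult alt_group_one)
  have proj_0: "eigenproj l t v = 0" if l: "l \<in> {\<omega>, \<omega> ^ 2}" for l
  proof (rule eigenvector_of_larger_depth[OF _ max abc t_def _ l])
    interpret e: Vector_Spaces.linear scale scale "eigenproj l t" by (rule linear_eigenproj[OF t'])
    have "\<rho> (block_cycle f i) (eigenproj l t v) = scale (eigval {..<k} Q i) (eigenproj l t v)"
      if i: "i < k" for i
    proof -
      have "i < n div 3" using i v by (auto simp: depth_vector_def)
      then have b: "block_cycle f i \<in> carrier (alt_group n)" using f by (rule block_cycle_alt[rotated])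
      have "block_cycle f i \<circ> t = t \<circ> block_cycle f i"
      proof -
        have "block_cycle f i (f x) = f x" if "x \<in> {3 * k + 1..n}" for x
          using that i inj unfolding block_cycle_def by (intro three_cycle_fixes) (auto simp: inj_eq)
        moreover have "inj (block_cycle f i)"
          using b by (auto simp: alt_group_carrier dest: permutes_inj)
        ultimately show ?thesis unfolding t_def using abc by (intro comp_three_cycle_commute) auto
      qed
      then have "eigenproj l t (\<rho> (block_cycle f i) v) = \<rho> (block_cycle f i) (eigenproj l t v)"
        using b t' by (intro eigenproj_commute) (simp_all add: alt_group_mult)
      then show ?thesis using v i by (simp add: depth_vector_def e.scale)
    qed
    then show "depth_vector k f Q (eigenproj l t v)"
      using v by (simp add: depth_vector_def)
    have "l ^ 3 = 1" using that eigval_cube[of "{0}" "{0}" 0] eigval_cube[of "{0}" "{}" 0]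
      by (auto simp: eigval_def)
    then show "\<rho> t (eigenproj l t v) = scale l (eigenproj l t v)"
      by (rule act_eigenproj[OF t' cube])
  qed
  show "\<rho> (three_cycle (f a) (f b) (f c)) v = v"
    using fixed_of_eigenproj_0[OF two \<omega> t' cube proj_0 proj_0] by (simp add: t_def)
qed

lemma tail_transpositions_fix:
  assumes v: "depth_vector k f Q v" and max: "maximal_depth k"
    and "a \<in> {3 * k + 1..n}" "b \<in> {3 * k + 1..n}" "c \<in> {3 * k + 1..n}" "d \<in> {3 * k + 1..n}"
    and "a \<noteq> b" "c \<noteq> d"
  shows "transpose (f a) (f b) \<circ> transpose (f c) (f d) \<in> carrier (alt_group n) \<and>
    \<rho> (transpose (f a) (f b) \<circ> transpose (f c) (f d)) v = v"
proof (rule transposition_pair_induct[where Y = "f ` {3 * k + 1..n}" and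
      P = "\<lambda>g. g \<in> carrier (alt_group n) \<and> \<rho> g v = v"])
  have f: "f permutes {1..n}" using v by (simp add: depth_vector_def)
  show "f a \<noteq> f b" "f c \<noteq> f d" using assms permutes_inj[OF f] by (simp_all add: inj_eq)
  show "three_cycle x y z \<in> carrier (alt_group n) \<and> \<rho> (three_cycle x y z) v = v"
    if "x \<in> f ` {3 * k + 1..n}" "y \<in> f ` {3 * k + 1..n}" "z \<in> f ` {3 * k + 1..n}" "distinct [x, y, z]"
    for x y z
  proof -
    obtain x' y' z' where eq: "x = f x'" "y = f y'" "z = f z'"
      and mem: "x' \<in> {3 * k + 1..n}" "y' \<in> {3 * k + 1..n}" "z' \<in> {3 * k + 1..n}"
      using \<open>x \<in> _\<close> \<open>y \<in> _\<close> \<open>z \<in> _\<close> by (elim imageE)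
    then have "distinct [x', y', z']" using \<open>distinct _\<close> by auto
    then show ?thesis using tail_three_cycle_fixes[OF v max mem] by (simp add: eq)
  qed
  show "id \<in> carrier (alt_group n) \<and> \<rho> id v = v"
    by (simp add: act_id alt_group_carrier permutes_id evenperm_id)
qed (use assms in \<open>auto simp: comp_alt act_comp\<close>)

text \<open>
  By counting: of the \<open>n - 3 * k\<close> points outside the first \<open>k\<close> blocks, at most \<open>3 * k\<close> can be sent
  into these blocks.
\<close>

lemma two_tail_points_stay:
  assumes f: "f permutes {1..n}" and g: "g permutes {1..n}" and k: "6 * k + 2 \<le> n"
  obtains a b c d where "a \<noteq> b" "c \<noteq> d" "g (f a) = f c" "g (f b) = f d"
    "{a, b, c, d} \<subseteq> {3 * k + 1..n}"
proof -
  let ?Y = "{3 * k + 1..n}"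
  have gf: "(g \<circ> f) permutes {1..n}" using f g by (rule permutes_compose)
  define B where "B = {a \<in> ?Y. g (f a) \<notin> f ` ?Y}"
  have "(g \<circ> f) ` B \<subseteq> f ` {1..3 * k}"
  proof
    fix y assume "y \<in> (g \<circ> f) ` B"
    then obtain a where a: "a \<in> ?Y" "y = g (f a)" "y \<notin> f ` ?Y" by (auto simp: B_def)
    then have "y \<in> {1..n}" using permutes_in_image[OF gf, of a] by auto
    then have "y \<in> f ` {1..n}" using permutes_image[OF f] by simp
    moreover have "{1..n} \<subseteq> {1..3 * k} \<union> ?Y" by auto
    ultimately show "y \<in> f ` {1..3 * k}" using a(3) by blast
  qed
  then have "card ((g \<circ> f) ` B) \<le> card {1..3 * k}"
    by (meson card_image_le card_mono finite_atLeastAtMost finite_imageI le_trans)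
  then have B: "card B \<le> 3 * k"
    using card_image[of "g \<circ> f" B] permutes_inj[OF gf] by (simp add: inj_on_subset)
  have "card (?Y - B) = card ?Y - card B" by (rule card_Diff_subset) (auto simp: B_def)
  then have "2 \<le> card (?Y - B)" using B k by simp
  then have "\<not> card (?Y - B) \<le> Suc 0" by simp
  then obtain a b where ab: "a \<in> ?Y - B" "b \<in> ?Y - B" "a \<noteq> b"
    by (subst (asm) card_le_Suc0_iff_eq) blast+
  then obtain c d where cd: "c \<in> ?Y" "d \<in> ?Y" "g (f a) = f c" "g (f b) = f d"
    unfolding B_def by blast
  moreover have "c \<noteq> d"
    using cd ab(3) permutes_inj[OF g] permutes_inj[OF f] by (metis injD)
  ultimately show ?thesis using that ab by blast
qed

text \<open>
  The matrix coefficient \<open>g \<mapsto> p (g v)\<close> does not change when \<open>g\<close> is multiplied on either side by even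
  permutations of the points outside the first \<open>k\<close> blocks. If \<open>g\<close> maps points \<open>a\<close>, \<open>b\<close> of this kind to
  points \<open>c\<close>, \<open>d\<close> of this kind, then \<open>g = (c d) g (a b)\<close>, and therefore
  \<open>s g s = (s (c d)) g ((a b) s)\<close> has the same coefficient as \<open>g\<close>.
\<close>

lemma extends_of_small_depth:
  assumes v: "depth_vector k f Q v" "v \<noteq> 0" and max: "maximal_depth k" and k: "6 * k + 2 \<le> n"
  shows "extends_to_sym n scale \<rho>"
proof -
  let ?Y = "{3 * k + 1..n}"
  have f: "f permutes {1..n}" using v by (simp add: depth_vector_def)
  note inj = permutes_inj[OF f]
  have blocks: "i < n div 3" if "i < k" for i using that k by auto
  define s where "s = transpose (f (3 * k + 1)) (f (3 * k + 2))"
  have Y: "3 * k + 1 \<in> ?Y" "3 * k + 2 \<in> ?Y" using k by auto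
  have s: "s permutes {1..n}" unfolding s_def
    using Y permutes_in_image[OF f] by (intro permutes_swap_id) auto
  have s_odd: "\<not> evenperm s" using inj by (simp add: s_def evenperm_swap inj_eq)
  have ss: "s \<circ> s = id" by (simp add: s_def)
  then have s_s: "s (s x) = x" for x by (metis comp_apply id_apply)
  obtain p where lin: "Vector_Spaces.linear scale scale p"
    and p_v: "\<And>v. (\<And>i. i < k \<Longrightarrow> \<rho> (block_cycle f i) v = scale (eigval {..<k} Q i) v) \<Longrightarrow> p v = v"
    and p_eig: "\<And>i v. i < k \<Longrightarrow> \<rho> (block_cycle f i) (p v) = scale (eigval {..<k} Q i) (p v)"
    and p_comm: "\<And>a v. a \<in> carrier (alt_group n)
      \<Longrightarrow> (\<And>i. i < k \<Longrightarrow> a \<otimes>\<^bsub>alt_group n\<^esub> block_cycle f i = block_cycle f i \<otimes>\<^bsub>alt_group n\<^esub> a)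
      \<Longrightarrow> p (\<rho> a v) = \<rho> a (p v)"
    by (rule joint_eigenprojection[OF two, of k "block_cycle f" "eigval {..<k} Q"])
      (simp_all add: block_cycle_alt[OF f] blocks alt_group_mult alt_group_one
        block_cycle_cube[OF inj] block_cycle_commute[OF inj] eigval_cube)
  have p_depth: "depth_vector k f Q (p u)" for u
    using v p_eig by (simp add: depth_vector_def)
  have "p v = v" using v by (intro p_v) (simp add: depth_vector_def)
  have coeff: "p (\<rho> (s \<circ> g \<circ> s) v) = p (\<rho> g v)" if g: "g \<in> carrier (alt_group n)" for g
  proof -
    have g_perm: "g permutes {1..n}" using g by (simp add: alt_group_carrier)
    obtain a b c d where ab: "a \<noteq> b" "c \<noteq> d" and g_ab: "g (f a) = f c" "g (f b) = f d"
      and abcd: "{a, b, c, d} \<subseteq> ?Y"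
      using two_tail_points_stay[OF f g_perm k] .
    define x where "x = s \<circ> transpose (f c) (f d)"
    define y where "y = transpose (f a) (f b) \<circ> s"
    have x: "x \<in> carrier (alt_group n)" "\<rho> x (p u) = p u" for u
      using tail_transpositions_fix[OF p_depth max, of "3 * k + 1" "3 * k + 2" c d] Y ab abcd
      by (auto simp: x_def s_def)
    have y: "y \<in> carrier (alt_group n)" "\<rho> y v = v"
      using tail_transpositions_fix[OF v(1) max, of a b "3 * k + 1" "3 * k + 2"] Y ab abcd
      by (auto simp: y_def s_def)
    have "transpose (f c) (f d) \<circ> g = g \<circ> transpose (f a) (f b)"
      using transpose_comp_conj[OF permutes_inj[OF g_perm], of "f a" "f b"] g_ab by simp
    then have "s \<circ> g \<circ> s = x \<circ> (g \<circ> y)"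
      unfolding x_def y_def by (simp add: fun_eq_iff s_s)
    then have "p (\<rho> (s \<circ> g \<circ> s) v) = p (\<rho> x (\<rho> g v))"
      using x(1) y g by (simp add: act_comp comp_alt)
    also have "\<dots> = \<rho> x (p (\<rho> g v))"
    proof (rule p_comm[OF x(1)])
      fix i assume i: "i < k"
      have "x \<circ> block_cycle f i = block_cycle f i \<circ> x"
      proof (rule comp_block_cycle_commute)
        show "inj x" using x(1) by (auto simp: alt_group_carrier dest: permutes_inj)
        show "x (f z) = f z" if z: "z \<in> {3 * i + 1..3 * i + 3}" for z
        proof -
          have "z \<notin> ?Y" using z i by auto
          then have "z \<notin> {c, d, 3 * k + 1, 3 * k + 2}" using abcd Y by blast
          then show ?thesis using inj by (simp add: x_def s_def transpose_def inj_eq)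
        qed
      qed
      then show "x \<otimes>\<^bsub>alt_group n\<^esub> block_cycle f i = block_cycle f i \<otimes>\<^bsub>alt_group n\<^esub> x"
        by (simp add: alt_group_mult)
    qed
    finally show ?thesis by (simp add: x(2))
  qed
  have perm: "permutation g" if "g permutes {1..n}" for g
    using that by (auto simp: permutation_permutes)
  have s_closed: "s \<circ> g \<circ> s \<in> carrier (alt_group n)" if "g \<in> carrier (alt_group n)" for g
    using that s s_odd perm
    by (simp add: alt_group_carrier permutes_compose evenperm_comp permutation_compose)
  obtain T where T: "Vector_Spaces.linear scale scale T" "\<And>v. T (T v) = v"
    "\<And>g v. g \<in> carrier (alt_group n) \<Longrightarrow> T (\<rho> g v) = \<rho> (s \<circ> g \<circ> s) (T v)"
    by (rule twist_involution[OF finite_alt, of "\<lambda>g. s \<circ> g \<circ> s" p v v])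
      (use s_closed coeff lin v \<open>p v = v\<close> in \<open>simp_all add: fun_eq_iff s_s alt_group_mult\<close>)
  show ?thesis by (rule extends_to_sym_of_twist[OF group_module_axioms s s_odd ss T])
qed

lemma nonzero_vector: obtains v :: 'v where "v \<noteq> 0"
  using nonzero by blast

text \<open>
  A vector of maximal depth is a weight vector for all blocks: the three-cycles of the blocks
  beyond the first \<open>k\<close> fix it.
\<close>

lemma weight_of_nonextending:
  assumes non: "\<not> extends_to_sym n scale \<rho>"
  obtains f S Q where "f permutes {1..n}" "weight f S Q" "Q \<subseteq> S" "S \<subseteq> {..<n div 3}"
    "n div 3 \<le> 2 * card S"
proof -
  define P where "P k \<longleftrightarrow> (\<exists>f Q v. depth_vector k f Q v \<and> v \<noteq> 0)" for k
  obtain u :: 'v where "u \<noteq> 0" by (rule nonzero_vector)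
  then have "P 0" unfolding P_def depth_vector_def using permutes_id by fastforce
  moreover have "k \<le> n" if "P k" for k using that by (auto simp: P_def depth_vector_def)
  ultimately obtain k where k: "P k" and "\<not> P (Suc k)"
    using Nat.ex_has_greatest_nat[of P 0 n] by (metis not_less_eq_eq order_refl)
  then have max: "maximal_depth k" by (auto simp: P_def maximal_depth_def)
  obtain f Q v where v: "depth_vector k f Q v" "v \<noteq> 0" using k by (auto simp: P_def)
  have f: "f permutes {1..n}" and kn: "3 * k \<le> n" using v by (simp_all add: depth_vector_def)
  have "\<not> 6 * k + 2 \<le> n" using extends_of_small_depth[OF v max] non by blast
  then have size: "n div 3 \<le> 2 * k" by auto
  have "\<rho> (block_cycle f i) v = scale (eigval {..<k} (Q \<inter> {..<k}) i) v" if i: "i < n div 3" for i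
  proof (cases "i < k")
    case True
    then show ?thesis using v by (simp add: depth_vector_def eigval_def)
  next
    case False
    then have "3 * k + 1 \<le> 3 * i + 1" "3 * i + 3 \<le> n" using i by auto
    then show ?thesis
      using tail_three_cycle_fixes(2)[OF v(1) max, of "3 * i + 1" "3 * i + 2" "3 * i + 3"] False
      by (simp add: block_cycle_def eigval_def)
  qed
  then have "weight f {..<k} (Q \<inter> {..<k})" unfolding weight_def using v(2) by blast
  then show ?thesis using that[OF f] kn size by auto
qed

lemma weight_comp_even:
  assumes g: "g \<in> carrier (alt_group n)" and f: "f permutes {1..n}" and w: "weight f S Q"
  shows "weight (g \<circ> f) S Q"
proof -
  obtain v where v: "v \<noteq> 0" "\<And>i. i < n div 3 \<Longrightarrow> \<rho> (block_cycle f i) v = scale (eigval S Q i) v"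
    using w by (auto simp: weight_def)
  have g_perm: "g permutes {1..n}" using g by (simp add: alt_group_carrier)
  have "\<rho> (block_cycle (g \<circ> f) i) (\<rho> g v) = scale (eigval S Q i) (\<rho> g v)" if i: "i < n div 3" for i
  proof -
    have "(g \<circ> f) permutes {1..n}" using f g_perm by (rule permutes_compose)
    then have "\<rho> (block_cycle (g \<circ> f) i) (\<rho> g v) = \<rho> (g \<circ> block_cycle f i) v"
      using i by (simp add: act_comp[OF block_cycle_alt g] block_cycle_conj[OF permutes_inj[OF g_perm]])
    then show ?thesis using g i f by (simp add: act_comp block_cycle_alt v act_scale)
  qed
  moreover have "\<rho> g v \<noteq> 0"
    using v(1) inj_prop[OF g] act_zero[OF g] by (metis UNIV_I inj_onD)
  ultimately show ?thesis unfolding weight_def by blast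
qed

lemma weight_permute_blocks:
  assumes \<pi>: "\<pi> permutes {..<n div 3}" and w: "weight f S Q"
  shows "weight (f \<circ> permute_blocks \<pi>) (\<pi> -` S) (\<pi> -` Q)"
proof -
  have "\<pi> i < n div 3" if "i < n div 3" for i
    using permutes_in_image[OF \<pi>, of i] that by simp
  moreover have "eigval (\<pi> -` S) (\<pi> -` Q) i = eigval S Q (\<pi> i)" for i by (simp add: eigval_def)
  ultimately show ?thesis
    using w unfolding weight_def block_cycle_permute_blocks by metis
qed

text \<open>
  Reversing a block inverts its three-cycle, which exchanges the eigenvalues \<open>\<omega>\<close> and \<open>\<omega>\<^sup>2\<close> and keeps
  \<open>1\<close>; hence the intersection with \<open>S\<close>.
\<close>

lemma weight_flip_blocks:
  assumes f: "f permutes {1..n}" and w: "weight f S Q" and Q: "Q \<subseteq> S"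
  shows "weight (f \<circ> flip_blocks E) S (sym_diff Q E \<inter> S)"
proof -
  obtain v where v: "v \<noteq> 0" "\<And>i. i < n div 3 \<Longrightarrow> \<rho> (block_cycle f i) v = scale (eigval S Q i) v"
    using w by (auto simp: weight_def)
  have "\<rho> (block_cycle (f \<circ> flip_blocks E) i) v = scale (eigval S (sym_diff Q E \<inter> S) i) v"
    if i: "i < n div 3" for i
  proof (cases "i \<in> E")
    case False
    then have "eigval S (sym_diff Q E \<inter> S) i = eigval S Q i" using Q by (auto simp: eigval_def)
    then show ?thesis using v i False by (simp add: block_cycle_flip_blocks)
  next
    case True
    have b: "block_cycle f i \<in> carrier (alt_group n)" using f i by (rule block_cycle_alt)
    have "block_cycle (f \<circ> flip_blocks E) i = block_cycle f i \<circ> block_cycle f i"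
      unfolding block_cycle_flip_blocks using True three_cycle_square[OF distinct_block[OF permutes_inj[OF f]]]
      by (simp add: block_cycle_def)
    then have "\<rho> (block_cycle (f \<circ> flip_blocks E) i) v = scale (eigval S Q i ^ 2) v"
      using b i by (simp add: act_comp v act_scale power2_eq_square)
    moreover have "eigval S Q i ^ 2 = eigval S (sym_diff Q E \<inter> S) i"
    proof -
      have "(\<omega> ^ 2) ^ 2 = \<omega> ^ 3 * \<omega>" by (simp add: power2_eq_square power3_eq_cube mult.assoc)
      then show ?thesis using True Q cube_root(1) by (auto simp: eigval_def)
    qed
    ultimately show ?thesis by simp
  qed
  then show ?thesis unfolding weight_def using v(1) by blast
qed

definition patterns :: "nat \<Rightarrow> (nat set \<times> nat set) set" where
  "patterns k = (SIGMA S:{S. S \<subseteq> {..<n div 3} \<and> card S = k}. Pow S)"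

lemma finite_patterns: "finite (patterns k)"
proof (rule finite_subset)
  show "patterns k \<subseteq> Pow {..<n div 3} \<times> Pow {..<n div 3}" by (auto simp: patterns_def)
qed simp

lemma card_patterns: "card (patterns k) = (n div 3 choose k) * 2 ^ k"
proof -
  let ?F = "{S. S \<subseteq> {..<n div 3} \<and> card S = k}"
  have "?F \<subseteq> Pow {..<n div 3}" by blast
  then have "finite ?F" by (rule finite_subset) simp
  have fin: "\<forall>S\<in>?F. finite (Pow S)"
    using finite_subset[OF _ finite_lessThan] by blast
  have "card (patterns k) = (\<Sum>S\<in>?F. card (Pow S))"
    unfolding patterns_def by (rule card_SigmaI[OF \<open>finite ?F\<close> fin])
  also have "\<dots> = (\<Sum>S\<in>?F. 2 ^ k)"
  proof (rule sum.cong[OF refl])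
    fix S assume S: "S \<in> ?F"
    with fin have "finite S" by blast
    with S show "card (Pow S) = 2 ^ k" by (simp add: card_Pow)
  qed
  also have "\<dots> = (n div 3 choose k) * 2 ^ k" using n_subsets[of "{..<n div 3}" k] by simp
  finally show ?thesis .
qed

text \<open>
  A permutation of the blocks followed by reversals gives any pattern, for some permutation \<open>f2\<close> in
  place of \<open>f\<close>. If \<open>f2\<close> is even, it can be replaced by the identity. If it is odd, a further
  reversal of block \<open>0\<close> makes it even, at the price of changing the pattern there.
\<close>

lemma weight_all_patterns:
  assumes n: "3 \<le> n" and f: "f permutes {1..n}" and w: "weight f S Q"
    and Q: "Q \<subseteq> S" "S \<subseteq> {..<n div 3}" and pat: "(S', Q') \<in> patterns (card S)"
  shows "weight id S' Q' \<or> weight id S' (sym_diff Q' {0} \<inter> S')"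
proof -
  have S': "S' \<subseteq> {..<n div 3}" "card S' = card S" "Q' \<subseteq> S'" using pat by (auto simp: patterns_def)
  obtain \<pi> where \<pi>: "\<pi> permutes {..<n div 3}" "\<pi> -` S = S'"
    by (rule exists_permutes_vimage[OF S'(1) Q(2) S'(2)])
  define f1 where "f1 = f \<circ> permute_blocks \<pi>"
  have f1: "f1 permutes {1..n}" unfolding f1_def
    by (rule permutes_compose[OF permute_blocks_permutes[OF \<pi>(1)] f])
  define Q1 where "Q1 = \<pi> -` Q"
  have w1: "weight f1 S' Q1" unfolding f1_def Q1_def \<pi>(2)[symmetric]
    by (rule weight_permute_blocks[OF \<pi>(1) w])
  have Q1: "Q1 \<subseteq> S'" unfolding Q1_def \<pi>(2)[symmetric] using Q(1) by blast
  define E where "E = sym_diff Q1 Q'"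
  define f2 where "f2 = f1 \<circ> flip_blocks E"
  have "E \<subseteq> {..<n div 3}" using Q1 S' by (auto simp: E_def)
  then have f2: "f2 permutes {1..n}" unfolding f2_def
    by (rule permutes_compose[OF flip_blocks_permutes f1])
  have "sym_diff Q1 E \<inter> S' = Q'" using Q1 S' by (auto simp: E_def)
  then have w2: "weight f2 S' Q'"
    unfolding f2_def using weight_flip_blocks[OF f1 w1 Q1, of E] by simp
  have even: "weight id S' R" if h: "h permutes {1..n}" "evenperm h" and w: "weight h S' R" for h R
  proof -
    have "inv' h \<in> carrier (alt_group n)"
      using h by (intro alt_group_inv_closed) (simp add: alt_group_carrier)
    from weight_comp_even[OF this h(1) w] show ?thesis
      using permutes_inv_o(2)[OF h(1)] by simp
  qed
  show ?thesis
  proof (cases "evenperm f2")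
    case True
    then show ?thesis using even[OF f2 _ w2] by blast
  next
    case False
    define f3 where "f3 = f2 \<circ> flip_blocks {0}"
    have fl: "flip_blocks {0} permutes {1..n}" by (rule flip_blocks_permutes) (use n in auto)
    then have "f3 permutes {1..n}" unfolding f3_def by (rule permutes_compose) (rule f2)
    moreover have "evenperm f3"
    proof -
      have "permutation f2" "permutation (flip_blocks {0})"
        using f2 fl by (auto simp: permutation_permutes)
      then show ?thesis using False flip_first_block_odd by (simp add: f3_def evenperm_comp)
    qed
    moreover have "weight f3 S' (sym_diff Q' {0} \<inter> S')"
      unfolding f3_def by (rule weight_flip_blocks[OF f2 w2 S'(3)])
    ultimately show ?thesis using even by blast
  qed
qed

text \<open>
  Different patterns differ in the eigenvalue of some block three-cycle, because \<open>1\<close>, \<open>\<omega>\<close> and \<open>\<omega>\<^sup>2\<close> are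
  distinct.
\<close>

lemma card_weights_le_dim:
  assumes W: "W \<subseteq> patterns k" "\<And>S Q. (S, Q) \<in> W \<Longrightarrow> weight id S Q"
  shows "card W \<le> dim (UNIV :: 'v set)"
proof -
  have "\<exists>v. v \<noteq> 0 \<and>
      (\<forall>i < n div 3. \<rho> (block_cycle id i) v = scale (eigval (fst x) (snd x) i) v)" if "x \<in> W" for x
    using W(2)[of "fst x" "snd x"] that by (simp add: weight_def)
  then obtain v where v: "\<And>x. x \<in> W \<Longrightarrow> v x \<noteq> 0"
    "\<And>x i. x \<in> W \<Longrightarrow> i < n div 3 \<Longrightarrow>
      \<rho> (block_cycle id i) (v x) = scale (eigval (fst x) (snd x) i) (v x)"
    by metis
  obtain u :: 'v where u: "u \<noteq> 0" by (rule nonzero_vector)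
  define B where "B = (\<lambda>g. \<rho> g u) ` carrier (alt_group n)"
  have "orbit_comb u c \<in> span B" for c
    unfolding orbit_comb_def B_def by (intro span_sum span_scale span_base) auto
  then have span: "span B = UNIV" using orbit_comb_surj[OF finite_alt u] by (metis UNIV_eq_I)
  show ?thesis
  proof (rule card_separated_eigenvectors_le_dim[where v = v and I = "{..<n div 3}" and
        f = "\<lambda>i. \<rho> (block_cycle id i)" and e = "\<lambda>i x. eigval (fst x) (snd x) i" and B = B])
    show "finite W" using W(1) finite_patterns by (rule finite_subset)
    show "Vector_Spaces.linear scale scale (\<rho> (block_cycle id i))" if "i \<in> {..<n div 3}" for i
      using that by (intro linear_action block_cycle_alt) (simp_all add: permutes_id)
    show "\<exists>i\<in>{..<n div 3}. eigval (fst x) (snd x) i \<noteq> eigval (fst y) (snd y) i"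
      if xy: "x \<in> W" "y \<in> W" "x \<noteq> y" for x y
    proof (rule ccontr)
      assume "\<not> ?thesis"
      then have eq: "eigval (fst x) (snd x) i = eigval (fst y) (snd y) i" if "i < n div 3" for i
        using that by blast
      have recover: "snd z = {i. i < n div 3 \<and> eigval (fst z) (snd z) i = \<omega>}"
        "fst z = {i. i < n div 3 \<and> eigval (fst z) (snd z) i \<noteq> 1}" if "z \<in> W" for z
        using subsetD[OF W(1) that] cube_root
        by (auto simp: patterns_def eigval_def split: if_splits)
      have "snd x = snd y"
        by (rule trans[OF recover(1)[OF xy(1)] trans[OF _ recover(1)[OF xy(2), symmetric]]])
          (use eq in auto)
      moreover have "fst x = fst y"
        by (rule trans[OF recover(2)[OF xy(1)] trans[OF _ recover(2)[OF xy(2), symmetric]]])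
          (use eq in auto)
      ultimately show False using xy(3) by (simp add: prod_eq_iff)
    qed
    show "finite B" unfolding B_def using finite_alt by simp
  qed (use v span in auto)
qed

text \<open>
  The involution \<open>\<Phi>\<close> on patterns reverses block \<open>0\<close>, and of every pattern and its image at least one is
  a weight for the standard blocks; hence at least half of all patterns are.
\<close>

lemma card_patterns_le_dim:
  assumes n: "3 \<le> n" and f: "f permutes {1..n}" and w: "weight f S Q"
    and Q: "Q \<subseteq> S" "S \<subseteq> {..<n div 3}"
  shows "card (patterns (card S)) \<le> 2 * dim (UNIV :: 'v set)"
proof -
  let ?P = "patterns (card S)"
  define W where "W = {(S', Q') \<in> ?P. weight id S' Q'}"
  define \<Phi> :: "nat set \<times> nat set \<Rightarrow> nat set \<times> nat set"
    where "\<Phi> = (\<lambda>(S', Q'). (S', sym_diff Q' {0} \<inter> S'))"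
  have "?P \<subseteq> W \<union> \<Phi> ` W"
  proof
    fix x assume x: "x \<in> ?P"
    then have \<Phi>: "\<Phi> x \<in> ?P" "\<Phi> (\<Phi> x) = x" by (auto simp: patterns_def \<Phi>_def)
    have "x \<in> W \<or> \<Phi> x \<in> W"
      using weight_all_patterns[OF n f w Q, of "fst x" "snd x"] x \<Phi>(1)
      by (cases x) (auto simp: W_def \<Phi>_def)
    then show "x \<in> W \<union> \<Phi> ` W" using \<Phi>(2) by (metis UnCI imageI)
  qed
  moreover have fin: "finite W" by (rule finite_subset[OF _ finite_patterns]) (auto simp: W_def)
  ultimately have "card ?P \<le> card W + card (\<Phi> ` W)"
    by (meson card_Un_le card_mono finite_UnI finite_imageI le_trans)
  also have "\<dots> \<le> 2 * card W" using card_image_le[OF fin, of \<Phi>] by simp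
  also have "\<dots> \<le> 2 * dim (UNIV :: 'v set)"
  proof -
    have "card W \<le> dim (UNIV :: 'v set)"
      by (rule card_weights_le_dim[of W "card S"]) (use W_def in blast)+
    then show ?thesis by simp
  qed
  finally show ?thesis .
qed

lemma two_power_le_dim:
  assumes "3 \<le> n" "\<not> extends_to_sym n scale \<rho>"
  shows "2 ^ (n div 3) \<le> 2 * dim (UNIV :: 'v set)"
proof -
  obtain f S Q where fSQ: "f permutes {1..n}" "weight f S Q" "Q \<subseteq> S" "S \<subseteq> {..<n div 3}"
    and S: "n div 3 \<le> 2 * card S"
    by (rule weight_of_nonextending[OF assms(2)])
  have "card S \<le> n div 3" using card_mono[OF _ fSQ(4)] by simp
  then have "2 ^ (n div 3) \<le> card (patterns (card S))"
    unfolding card_patterns using S by (rule two_power_le_binomial)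
  also have "\<dots> \<le> 2 * dim (UNIV :: 'v set)" by (rule card_patterns_le_dim[OF assms(1) fSQ])
  finally show ?thesis .
qed

end

lemma alg_closed_primitive_cube_root:
  obtains \<omega> :: "'a::alg_closed_field" where "\<omega> ^ 2 + \<omega> + 1 = 0"
proof -
  obtain \<omega> :: 'a where "poly [:1, 1, 1:] \<omega> = 0"
    using alg_closed_imp_poly_has_root[of "[:1, 1, 1 :: 'a:]"] by auto
  then show ?thesis using that[of \<omega>] by (simp add: algebra_simps power2_eq_square)
qed

theorem proposition4p1:
  fixes scale :: "'a::alg_closed_field \<Rightarrow> 'v::ab_group_add \<Rightarrow> 'v"
    and \<rho> :: "(nat \<Rightarrow> nat) \<Rightarrow> 'v \<Rightarrow> 'v"
    and n :: nat
  assumes "CHAR('a) = 2"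
    and "n \<ge> 5"
    and "irreducible_group_module (alt_group n) scale \<rho>"
    and "\<not> extends_to_sym n scale \<rho>"
  shows "real (vector_space.dim scale (UNIV :: 'v set)) \<ge> 2 powr ((real n - 6) / 4)"
proof -
  have two: "(1::'a) + 1 = 0" using of_nat_CHAR[where 'a = 'a] assms(1) by simp
  obtain \<omega> :: 'a where \<omega>: "\<omega> ^ 2 + \<omega> + 1 = 0" by (rule alg_closed_primitive_cube_root)
  interpret alt_irreducible n scale \<rho> \<omega>
    by (intro alt_irreducible.intro alt_irreducible_axioms.intro assms(3) two \<omega>)
  have "n \<le> 3 * (n div 3) + 2" by presburger
  then have "real n \<le> real (3 * (n div 3) + 2)" by (rule of_nat_mono)
  then have "(real n - 6) / 4 \<le> real (n div 3) - 1" using assms(2) by simp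
  then have "2 powr ((real n - 6) / 4) \<le> 2 powr (real (n div 3) - 1)" by simp
  also have "\<dots> = 2 ^ (n div 3) / 2" by (simp add: powr_diff powr_realpow)
  also have "\<dots> \<le> real (dim (UNIV :: 'v set))"
  proof -
    have "real (2 ^ (n div 3)) \<le> real (2 * dim (UNIV :: 'v set))"
      using two_power_le_dim assms(2,4) by (intro of_nat_mono) simp
    then show ?thesis by simp
  qed
  finally show ?thesis .
qed

end
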